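(* Let $(A_n)_{n\ge1}$ be a sequence of Hermitian matrices, $A_n$ of size $n\times n$, such that $(A_n)_{i,i}=0$ for any $i\in\{1,\dots,n\}$. Assume that the empirical distribution of eigenvalues $\mu_{A_n}$ converges weakly to the Dirac mass at $0$ and that $\limsup_n n^{-1}\mathrm{tr}A_n^2<+\infty$. Let $\mu$ be the uniform probability measure on $\{-1,1\}^n$. Then, as $n\to+\infty$, $$\log\int e^{\langle\sigma,A_n\sigma\rangle}d\mu(\sigma)=\sup_{x\in[-1,1]^n}\big\{\langle x,A_nx\rangle-\Lambda^*_\mu(x)\big\}+o(n).$$
   Context: For a Hermitian $n\times n$ matrix $A$ with eigenvalues $\lambda_1,\dots,\lambda_n$, $\mu_A=\frac1n\sum_{i=1}^n\delta_{\lambda_i}$. For a probability measure $\mu$ on $\mathbb{R}^n$, $\Lambda_\mu(\lambda)=\log\int e^{\langle\lambda,x\rangle}d\mu(x)$ and $\Lambda^*_\mu(x)=\sup_{\lambda\in\mathbb{R}^n}\{\langle\lambda,x\rangle-\Lambda_\mu(\lambda)\}$. *)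

theory Defs
  imports
    "HOL-Probability.Probability"
    "HOL-Library.Landau_Symbols"
    "Jordan_Normal_Form.Schur_Decomposition"
begin

text \<open>
  The space \<open>\<real>\<^sup>n\<close> with its Borel sigma-algebra, for varying \<open>n\<close>, is the finite product
  \<open>\<Pi>\<^sub>M i\<in>{..<n}. borel\<close>: vectors are extensional functions on \<open>{..<n}\<close>, and
  coordinates are numbered from \<open>0\<close>, in line with matrix indices.
\<close>

abbreviation euclid :: "nat \<Rightarrow> (nat \<Rightarrow> real) measure" where
  "euclid n \<equiv> (\<Pi>\<^sub>M i\<in>{..<n}. borel)"

definition dot :: "nat \<Rightarrow> (nat \<Rightarrow> real) \<Rightarrow> (nat \<Rightarrow> real) \<Rightarrow> real" where
  "dot n x y = (\<Sum>i<n. x i * y i)"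

text \<open>The logarithmic Laplace transform takes the value \<open>\<infinity>\<close> where the integral diverges.\<close>

definition log_laplace :: "nat \<Rightarrow> (nat \<Rightarrow> real) measure \<Rightarrow> (nat \<Rightarrow> real) \<Rightarrow> ereal" where
  "log_laplace n \<mu> l =
     (if integrable \<mu> (\<lambda>x. exp (dot n l x))
      then ereal (ln (\<integral>x. exp (dot n l x) \<partial>\<mu>)) else \<infinity>)"

definition log_laplace_conj :: "nat \<Rightarrow> (nat \<Rightarrow> real) measure \<Rightarrow> (nat \<Rightarrow> real) \<Rightarrow> ereal" where
  "log_laplace_conj n \<mu> x =
     (SUP l\<in>space (euclid n). ereal (dot n l x) - log_laplace n \<mu> l)"

definition uniform_cube :: "nat \<Rightarrow> (nat \<Rightarrow> real) measure" where
  "uniform_cube n =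
     distr (uniform_count_measure ({..<n} \<rightarrow>\<^sub>E {-1, 1})) (euclid n) (\<lambda>x. x)"

definition hermitian_mat :: "nat \<Rightarrow> complex mat \<Rightarrow> bool" where
  "hermitian_mat n A \<longleftrightarrow> A \<in> carrier_mat n n \<and> mat_adjoint A = A"

definition mat_trace :: "'a :: comm_monoid_add mat \<Rightarrow> 'a" where
  "mat_trace A = (\<Sum>i<dim_row A. A $$ (i, i))"

text \<open>
  The real part below discards nothing when \<open>A\<close> is Hermitian, since
  \<open>\<langle>x, A x\<rangle>\<close> is then a real number.
\<close>

definition quad_form :: "nat \<Rightarrow> complex mat \<Rightarrow> (nat \<Rightarrow> real) \<Rightarrow> real" where
  "quad_form n A x =
     Re (\<Sum>i<n. \<Sum>j<n. complex_of_real (x i) * A $$ (i, j) * complex_of_real (x j))"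

text \<open>
  The multiset \<open>proots (char_poly A)\<close> lists the eigenvalues of a square matrix with
  multiplicity; they are real when \<open>A\<close> is Hermitian, and \<open>Re\<close> only changes their type.
  The value is meaningless for the \<open>0 \<times> 0\<close> matrix.
\<close>

definition empirical_spectral_measure :: "complex mat \<Rightarrow> real measure" where
  "empirical_spectral_measure A =
     distr (measure_pmf (pmf_of_multiset (proots (char_poly A)))) borel Re"

end

theory Submission
  imports Defs
begin

text \<open>
  Lower bound: tilting the uniform measure by \<open>exp \<langle>l, \<sigma>\<rangle>\<close> gives a product measure, whose mean
  of \<open>\<langle>\<sigma>, A \<sigma>\<rangle>\<close> is the value at the barycentre because the diagonal of \<open>A\<close> vanishes; Jensen's
  inequality concludes, without any error term.

  Upper bound: up to an error \<open>\<epsilon> n\<close>, the form \<open>\<langle>\<sigma>, A \<sigma>\<rangle>\<close> depends on \<open>\<sigma>\<close> only through its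
  coordinates along the \<open>o(n)\<close> eigenvectors with \<open>\<bar>\<lambda>\<bar> > \<epsilon>\<close>. Cut the cube into cells by rounding
  these coordinates to multiples of a fixed \<open>\<delta>\<close>. As \<open>tr A\<^sup>2 = O(n)\<close>, the form oscillates by
  \<open>O(\<delta> n)\<close> on the convex hull of a cell, and there are only \<open>exp (o(n))\<close> cells. If \<open>x\<close> is the
  barycentre of a cell \<open>D\<close>, Jensen's inequality applied to the uniform measure on \<open>D\<close> yields
  \<open>\<Lambda>\<^sup>* x \<le> - ln (\<mu> D)\<close>, so each cell contributes at most \<open>exp (sup + O((\<epsilon> + \<delta>) n))\<close>.
\<close>

section \<open>Unitary diagonalisation of Hermitian matrices\<close>

lemma mat_adjoint_index:
  "i < dim_col A \<Longrightarrow> j < dim_row A \<Longrightarrow> mat_adjoint A $$ (i, j) = conjugate (A $$ (j, i))"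
  by (simp add: mat_adjoint_def mat_of_rows_index)

lemma mat_adjoint_carrier: "A \<in> carrier_mat n m \<Longrightarrow> mat_adjoint A \<in> carrier_mat m n"
  by (auto simp: mat_adjoint_def)

lemma mat_adjoint_mult:
  fixes A B :: "complex mat"
  assumes "A \<in> carrier_mat n m" "B \<in> carrier_mat m p"
  shows "mat_adjoint (A * B) = mat_adjoint B * mat_adjoint A"
proof (rule eq_matI)
  note c = mat_adjoint_carrier[OF assms(1)] mat_adjoint_carrier[OF assms(2)]
  show "dim_row (mat_adjoint (A * B)) = dim_row (mat_adjoint B * mat_adjoint A)"
       "dim_col (mat_adjoint (A * B)) = dim_col (mat_adjoint B * mat_adjoint A)"
    using assms c by (auto simp: mat_adjoint_def)
  fix i j assume "i < dim_row (mat_adjoint B * mat_adjoint A)" "j < dim_col (mat_adjoint B * mat_adjoint A)"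
  then have ij: "i < p" "j < n" using assms c by auto
  then show "mat_adjoint (A * B) $$ (i, j) = (mat_adjoint B * mat_adjoint A) $$ (i, j)"
    using assms c
    by (subst mat_adjoint_index) (auto simp: scalar_prod_def mat_adjoint_index intro!: sum.cong)
qed

lemma mat_adjoint_adjoint: "mat_adjoint (mat_adjoint A) = (A :: complex mat)"
  by (rule eq_matI) (auto simp: mat_adjoint_index mat_adjoint_def mat_of_rows_index)

definition diag_of :: "nat \<Rightarrow> (nat \<Rightarrow> complex) \<Rightarrow> complex mat" where
  "diag_of n d = Matrix.mat n n (\<lambda>(i, j). if i = j then d i else 0)"

text \<open>Gram-Schmidt applied to a basis that begins with \<open>v\<close> keeps its first
  vector, so only the normalisation rescales it; hence the scalar \<open>c\<close>. This supplies
  the change of basis for the induction step of the diagonalisation.\<close>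

lemma unitary_first_column:
  fixes v :: "complex Matrix.vec"
  assumes v: "v \<in> carrier_vec n" and v0: "v \<noteq> 0\<^sub>v n"
  shows "\<exists>W c. W \<in> carrier_mat n n \<and> mat_adjoint W * W = 1\<^sub>m n \<and> col W 0 = c \<cdot>\<^sub>v v"
proof -
  interpret cof_vec_space n "TYPE(complex)" .
  define b where "b = basis_completion v"
  define ws where "ws = gram_schmidt n b"
  have n: "n \<noteq> 0"
  proof
    assume "n = 0"
    then have "v = 0\<^sub>v n" using v by (intro eq_vecI) auto
    with v0 show False by simp
  qed
  from basis_completion[OF v v0, folded b_def]
  have span_b: "span (set b) = carrier_vec n" and dist_b: "distinct b" 
    and indep: "\<not> lin_dep (set b)" and b: "set b \<subseteq> carrier_vec n" and hdb: "hd b = v" 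
    and len_b: "length b = n" by auto
  from hdb len_b n obtain vs where bv: "b = v # vs" by (cases b) auto
  from gram_schmidt_result[OF b dist_b indep refl, folded ws_def]
  have ws: "set ws \<subseteq> carrier_vec n" "corthogonal ws" "length ws = n" 
    by (auto simp: len_b)
  from gram_schmidt_hd[OF v, of vs, folded bv] have hdws: "hd ws = v" unfolding ws_def .
  \<comment> \<open>The vectors \<open>ws\<close> are orthogonal but not normalised;
    \<open>N j\<close> is the squared length to be divided out.\<close>
  define N where "N j = (\<Sum>i<n. (cmod (vec_index (ws ! j) i))\<^sup>2)" for j
  define W where "W = Matrix.mat n n (\<lambda>(i, j). vec_index (ws ! j) i / of_real (sqrt (N j)))"
  have dimws: "dim_vec (ws ! j) = n" if "j < n" for j
    using ws(1) nth_mem[of j ws] that unfolding ws(3) by (metis carrier_vecD subsetD)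
  have ip: "ws ! i \<bullet>c ws ! j = (\<Sum>k<n. vec_index (ws ! i) k * cnj (vec_index (ws ! j) k))" if "i < n" "j < n" for i j
    using dimws that by (simp add: scalar_prod_def lessThan_atLeast0)
  have NN: "(\<Sum>k<n. vec_index (ws ! i) k * cnj (vec_index (ws ! i) k)) = of_real (N i)" for i
    unfolding N_def of_real_sum by (intro sum.cong refl) (simp only: complex_norm_square)
  have Npos: "N i > 0" if "i < n" for i
  proof -
    have "ws ! i \<bullet>c ws ! i \<noteq> 0" using corthogonalD[OF ws(2), of i i] ws(3) that by auto
    then have "N i \<noteq> 0" using ip[OF that that] NN[of i] by auto
    moreover have "N i \<ge> 0" unfolding N_def by (intro sum_nonneg) auto
    ultimately show ?thesis by linarith
  qed
  have W: "W \<in> carrier_mat n n" by (auto simp: W_def)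
  have "mat_adjoint W * W = 1\<^sub>m n"
  proof (rule eq_matI)
    fix i j assume "i < dim_row (1\<^sub>m n :: complex mat)" "j < dim_col (1\<^sub>m n :: complex mat)"
    then have ij: "i < n" "j < n" by auto
    have "(mat_adjoint W * W) $$ (i, j) = (\<Sum>k<n. cnj (W $$ (k, i)) * W $$ (k, j))"
      using ij W mat_adjoint_carrier[OF W]
      by (simp add: scalar_prod_def mat_adjoint_index lessThan_atLeast0)
    also have "\<dots> = (\<Sum>k<n. vec_index (ws ! j) k * cnj (vec_index (ws ! i) k)) / of_real (sqrt (N i) * sqrt (N j))"
      unfolding sum_divide_distrib using ij by (intro sum.cong) (auto simp: W_def field_simps)
    also have "\<dots> = (if i = j then 1 else 0)"
    proof (cases "i = j")
      case True
      then show ?thesis using Npos[OF ij(1)] NN[of i]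
        by (simp add: abs_of_pos real_sqrt_mult_self flip: of_real_mult)
    next
      case False
      then have "ws ! j \<bullet>c ws ! i = 0" using corthogonalD[OF ws(2), of j i] ws(3) ij by auto
      then show ?thesis using ip[OF ij(2) ij(1)] False by auto
    qed
    finally show "(mat_adjoint W * W) $$ (i, j) = 1\<^sub>m n $$ (i, j)" using ij by auto
  qed (use W mat_adjoint_carrier[OF W] in auto)
  moreover have "col W 0 = (1 / of_real (sqrt (N 0))) \<cdot>\<^sub>v v"
  proof (rule eq_vecI)
    have w0: "ws ! 0 = v" using hdws hd_conv_nth[of ws] ws n by force
    show "dim_vec (col W 0) = dim_vec ((1 / of_real (sqrt (N 0))) \<cdot>\<^sub>v v)" using W v by auto
    fix i assume "i < dim_vec ((1 / of_real (sqrt (N 0))) \<cdot>\<^sub>v v)"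
    then have i: "i < n" using v by auto
    then show "vec_index (col W 0) i = vec_index ((1 / of_real (sqrt (N 0))) \<cdot>\<^sub>v v) i"
      using W n v w0 by (simp add: W_def)
  qed
  ultimately show ?thesis using W by blast
qed

lemma adjoint_four_block_corner:
  assumes U: "(U :: complex mat) \<in> carrier_mat m m"
  shows "mat_adjoint (four_block_mat (1\<^sub>m 1) (0\<^sub>m 1 m) (0\<^sub>m m 1) U)
       = four_block_mat (1\<^sub>m 1) (0\<^sub>m 1 m) (0\<^sub>m m 1) (mat_adjoint U)"
  using U by (intro eq_matI) (auto simp: mat_adjoint_index mat_adjoint_carrier mat_adjoint_def mat_of_rows_index)

text \<open>Deflation: conjugating by a unitary matrix whose first column is an eigenvector turns
  the first column of \<open>B\<close> into a multiple of the first basis vector. Hermitian symmetry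
  clears the first row as well, and the induction hypothesis applies to the remaining block.\<close>

lemma hermitian_unitary_diagonalization:
  assumes "hermitian_mat n A"
  shows "\<exists>U d. U \<in> carrier_mat n n \<and> mat_adjoint U * U = 1\<^sub>m n \<and> U * mat_adjoint U = 1\<^sub>m n \<and>
    A = U * diag_of n d * mat_adjoint U"
  using assms
proof (induction n arbitrary: A)
  case 0
  then have "A \<in> carrier_mat 0 0" by (simp add: hermitian_mat_def)
  then show ?case by (intro exI[of _ "1\<^sub>m 0"] exI[of _ "\<lambda>_. 0"] conjI) (auto intro!: eq_matI simp: mat_adjoint_def)
next
  case (Suc m)
  let ?n = "Suc m"
  from Suc.prems have A: "A \<in> carrier_mat ?n ?n" and hA: "mat_adjoint A = A" by (auto simp: hermitian_mat_def)
  have "degree (char_poly A) = ?n" using degree_monic_char_poly[OF A] by simp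
  then have "\<not> constant (poly (char_poly A))" by (simp add: constant_degree)
  then obtain e where "poly (char_poly A) e = 0" using fundamental_theorem_of_algebra by blast
  then have "eigenvalue A e" using eigenvalue_root_char_poly[OF A] by simp
  then obtain v where v: "v \<in> carrier_vec ?n" "v \<noteq> 0\<^sub>v ?n" "A *\<^sub>v v = e \<cdot>\<^sub>v v"
    using A unfolding eigenvalue_def eigenvector_def by auto
  from unitary_first_column[OF v(1,2)] obtain W c where
    W: "W \<in> carrier_mat ?n ?n" and WW: "mat_adjoint W * W = 1\<^sub>m ?n" and W0: "col W 0 = c \<cdot>\<^sub>v v" by blast
  define W' where "W' = mat_adjoint W"
  have W': "W' \<in> carrier_mat ?n ?n" unfolding W'_def by (rule mat_adjoint_carrier[OF W])
  have W'W: "W' * W = 1\<^sub>m ?n" using WW by (simp add: W'_def)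
  have WW': "W * W' = 1\<^sub>m ?n" by (rule mat_mult_left_right_inverse[OF W' W W'W])
  define B where "B = W' * A * W"
  have B: "B \<in> carrier_mat ?n ?n" using W W' A by (auto simp: B_def)
  have hB: "mat_adjoint B = B"
  proof -
    have "mat_adjoint (W' * A * W) = W' * (A * W)"
      using mat_adjoint_mult[of "W' * A" ?n ?n W ?n] mat_adjoint_mult[of W' ?n ?n A ?n] W W' A
      by (simp add: hA) (simp add: W'_def mat_adjoint_adjoint)
    then show ?thesis unfolding B_def using W W' A by simp
  qed
  have AW0: "A *\<^sub>v col W 0 = e \<cdot>\<^sub>v col W 0"
    unfolding W0 using A v by (simp add: mult_mat_vec smult_smult_assoc mult.commute)
  \<comment> \<open>\<open>A\<close> multiplies \<open>col W 0\<close> by \<open>e\<close>, so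
    column 0 of \<open>W' * A * W\<close> is \<open>e\<close> times column 0 of
    \<open>W' * W\<close>, which is the identity.\<close>
  have B0: "B $$ (i, 0) = (if i = 0 then e else 0)" if i: "i < ?n" for i
  proof -
    have "B $$ (i, 0) = (W' * (A * W)) $$ (i, 0)" unfolding B_def using A W W' by simp
    also have "\<dots> = row W' i \<bullet> (A *\<^sub>v col W 0)" using A W W' i by (simp add: mult_mat_vec_def)
    also have "\<dots> = e * (row W' i \<bullet> col W 0)" unfolding AW0 using W W' by simp
    also have "row W' i \<bullet> col W 0 = (W' * W) $$ (i, 0)" using W W' i by simp
    also have "e * \<dots> = (if i = 0 then e else 0)" unfolding W'W using i by simp
    finally show ?thesis .
  qed
  define A3 where "A3 = Matrix.mat m m (\<lambda>(i, j). B $$ (Suc i, Suc j))"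
  have A3: "A3 \<in> carrier_mat m m" by (simp add: A3_def)
  have Bsym: "B $$ (i, j) = cnj (B $$ (j, i))" if "i < ?n" "j < ?n" for i j
  proof -
    have "mat_adjoint B $$ (i, j) = conjugate (B $$ (j, i))" by (rule mat_adjoint_index) (use B that in auto)
    then show ?thesis by (simp add: hB)
  qed
  have "hermitian_mat m A3"
    unfolding hermitian_mat_def
  proof
    show "mat_adjoint A3 = A3"
    proof (rule eq_matI)
      fix i j assume "i < dim_row A3" "j < dim_col A3"
      then show "mat_adjoint A3 $$ (i, j) = A3 $$ (i, j)"
        using A3 Bsym[of "Suc i" "Suc j"] by (subst mat_adjoint_index) (auto simp: A3_def)
    qed (use A3 mat_adjoint_carrier[OF A3] in auto)
  qed (rule A3)
  from Suc.IH[OF this] obtain U d where U: "U \<in> carrier_mat m m" "mat_adjoint U * U = 1\<^sub>m m"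
    "U * mat_adjoint U = 1\<^sub>m m" "A3 = U * diag_of m d * mat_adjoint U" by blast
  have U': "mat_adjoint U \<in> carrier_mat m m" by (rule mat_adjoint_carrier[OF U(1)])
  let ?fb = "\<lambda>z M. four_block_mat z (0\<^sub>m 1 m) (0\<^sub>m m 1) M"
  define E where "E = (Matrix.mat 1 1 (\<lambda>_. e))"
  have E: "E \<in> carrier_mat 1 1" by (simp add: E_def)
  have dm: "diag_of m d \<in> carrier_mat m m" by (simp add: diag_of_def)
  define d' where "d' i = (case i of 0 \<Rightarrow> e | Suc k \<Rightarrow> d k)" for i
  have D': "diag_of ?n d' = ?fb E (diag_of m d)"
    by (rule eq_matI) (auto simp: diag_of_def E_def d'_def split: nat.splits)
  have Bfb: "B = ?fb E A3"
  proof (rule eq_matI)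
    fix i j assume "i < dim_row (?fb E A3)" "j < dim_col (?fb E A3)"
    then have ij: "i < ?n" "j < ?n" using A3 E by auto
    show "B $$ (i, j) = ?fb E A3 $$ (i, j)"
      using ij A3 E B0[OF ij(1)] Bsym[OF ij] B0[OF ij(2)]
      by (cases i; cases j) (auto simp: A3_def E_def)
  qed (use A3 E B in auto)
  define Q where "Q = ?fb (1\<^sub>m 1) U"
  have Q: "Q \<in> carrier_mat ?n ?n" using U by (auto simp: Q_def)
  have Q': "mat_adjoint Q = ?fb (1\<^sub>m 1) (mat_adjoint U)" unfolding Q_def by (rule adjoint_four_block_corner[OF U(1)])
  have Q'c: "mat_adjoint Q \<in> carrier_mat ?n ?n" by (rule mat_adjoint_carrier[OF Q])
  have fbone: "?fb (1\<^sub>m 1) (1\<^sub>m m) = 1\<^sub>m ?n"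
    by (rule eq_matI) auto
  have one_dim: "(1\<^sub>m (1 + m) :: complex mat) = 1\<^sub>m ?n" by simp
  have fbmult: "?fb X Y * ?fb X2 Y2 = ?fb (X * X2) (Y * Y2)"
    if "X \<in> carrier_mat 1 1" "X2 \<in> carrier_mat 1 1" "Y \<in> carrier_mat m m" "Y2 \<in> carrier_mat m m" for X X2 Y Y2 :: "complex mat"
    using that by (subst mult_four_block_mat[of _ 1 1 _ m _ m]) auto
  have QQ: "mat_adjoint Q * Q = 1\<^sub>m ?n" "Q * mat_adjoint Q = 1\<^sub>m ?n"
    unfolding Q' using U U' by (simp_all add: Q_def fbmult fbone one_dim del: One_nat_def)
  have DC: "diag_of ?n d' \<in> carrier_mat ?n ?n" by (simp add: diag_of_def)
  have BQ: "B = Q * diag_of ?n d' * mat_adjoint Q"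
    unfolding Q' D' Bfb U(4) using U U' E dm by (simp add: Q_def fbmult del: One_nat_def)
  have Aeq: "A = W * B * W'"
  proof -
    have "W * B * W' = (W * W') * A * (W * W')" unfolding B_def
      using A W W' by (simp add: assoc_mult_mat[of _ ?n ?n _ ?n _ ?n])
    then show ?thesis unfolding WW' using A by simp
  qed
  have adj: "mat_adjoint (W * Q) = mat_adjoint Q * W'" unfolding W'_def by (rule mat_adjoint_mult[OF W Q])
  show ?case
  proof (intro exI conjI)
    show "W * Q \<in> carrier_mat ?n ?n" using W Q by auto
    have "mat_adjoint (W * Q) * (W * Q) = mat_adjoint Q * ((W' * W) * Q)" unfolding adj
      using W W' Q Q'c by (simp add: assoc_mult_mat[of _ ?n ?n _ ?n _ ?n] mult_carrier_mat[of _ ?n ?n _ ?n])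
    then show 1: "mat_adjoint (W * Q) * (W * Q) = 1\<^sub>m ?n" unfolding W'W using Q QQ by simp
    show "W * Q * mat_adjoint (W * Q) = 1\<^sub>m ?n" 
      by (rule mat_mult_left_right_inverse[OF _ _ 1]) (use W Q W' Q'c adj in auto)
    show "A = W * Q * diag_of ?n d' * mat_adjoint (W * Q)" unfolding adj Aeq
      by (subst BQ) (use W W' Q Q'c DC in \<open>simp add: assoc_mult_mat[of _ ?n ?n _ ?n _ ?n] mult_carrier_mat[of _ ?n ?n _ ?n]\<close>)
  qed
qed


text \<open>Here \<open>u i k\<close> is coordinate \<open>i\<close> of the eigenvector for
  \<open>d k\<close>. Of the two orthonormality relations of a unitary matrix, the one that sums
  over eigenvectors is exported, since it yields Parseval's identity for the coordinates of a vector
  in the eigenbasis.\<close>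

lemma hermitian_spectral_decomposition:
  assumes h: "hermitian_mat n A"
  obtains d :: "nat \<Rightarrow> real" and u :: "nat \<Rightarrow> nat \<Rightarrow> complex" where
    "\<And>i j. i < n \<Longrightarrow> j < n \<Longrightarrow> A $$ (i, j) = (\<Sum>k<n. of_real (d k) * u i k * cnj (u j k))"
    "\<And>i j. i < n \<Longrightarrow> j < n \<Longrightarrow> (\<Sum>k<n. u i k * cnj (u j k)) = (if i = j then 1 else 0)"
    "proots (char_poly A) = mset (map (\<lambda>k. complex_of_real (d k)) [0..<n])"
    "mat_trace (A * A) = of_real (\<Sum>k<n. (d k)\<^sup>2)"
proof -
  from h have A: "A \<in> carrier_mat n n" and hA: "mat_adjoint A = A" by (auto simp: hermitian_mat_def)
  from hermitian_unitary_diagonalization[OF h] obtain U d where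
    U: "U \<in> carrier_mat n n" and U'U: "mat_adjoint U * U = 1\<^sub>m n" and UU': "U * mat_adjoint U = 1\<^sub>m n"
    and AU: "A = U * diag_of n d * mat_adjoint U" by blast
  define V where "V = mat_adjoint U"
  have V: "V \<in> carrier_mat n n" unfolding V_def by (rule mat_adjoint_carrier[OF U])
  have Vi: "V $$ (k, j) = cnj (U $$ (j, k))" if "k < n" "j < n" for j k
    unfolding V_def using mat_adjoint_index[of k U j] U that by auto
  note VU = U'U[folded V_def] and UV = UU'[folded V_def] and AUV = AU[folded V_def]
  have D: "diag_of n c \<in> carrier_mat n n" for c by (simp add: diag_of_def)
  have DD: "diag_of n c * diag_of n c' = diag_of n (\<lambda>i. c i * c' i)" for c c'
    by (rule eq_matI) (auto simp: diag_of_def scalar_prod_def if_distrib[of "\<lambda>x. x * _"] cong: if_cong)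
  have UD: "(U * diag_of n c) $$ (i, k) = U $$ (i, k) * c k" if "i < n" "k < n" for i k c
    using U that by (auto simp: diag_of_def scalar_prod_def if_distrib[of "\<lambda>x. _ * x"] cong: if_cong)
  have UDV: "(U * diag_of n c * V) $$ (i, j) = (\<Sum>k<n. c k * U $$ (i, k) * cnj (U $$ (j, k)))"
    if "i < n" "j < n" for i j c
  proof -
    have "(X * V) $$ (i, j) = (\<Sum>k<n. X $$ (i, k) * V $$ (k, j))" if "X \<in> carrier_mat n n" for X
      using that V \<open>i < n\<close> \<open>j < n\<close> by (simp add: scalar_prod_def lessThan_atLeast0)
    from this[of "U * diag_of n c"]
    have "(U * diag_of n c * V) $$ (i, j) = (\<Sum>k<n. (U * diag_of n c) $$ (i, k) * V $$ (k, j))"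
      using U D[of c] by simp
    also have "\<dots> = (\<Sum>k<n. c k * U $$ (i, k) * cnj (U $$ (j, k)))"
      using that by (intro sum.cong) (simp_all add: UD Vi)
    finally show ?thesis .
  qed
  have rows: "(\<Sum>k<n. U $$ (i, k) * cnj (U $$ (j, k))) = (if i = j then 1 else 0)" if "i < n" "j < n" for i j
  proof -
    have "(\<Sum>k<n. U $$ (i, k) * cnj (U $$ (j, k))) = (U * V) $$ (i, j)"
      using U V that by (simp add: scalar_prod_def lessThan_atLeast0 Vi)
    then show ?thesis using that by (simp add: UV)
  qed
  have cols: "(\<Sum>i<n. U $$ (i, k) * cnj (U $$ (i, k))) = 1" if "k < n" for k
  proof -
    have "(\<Sum>i<n. U $$ (i, k) * cnj (U $$ (i, k))) = (V * U) $$ (k, k)"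
      using U V that by (simp add: scalar_prod_def lessThan_atLeast0 Vi mult.commute)
    then show ?thesis using that by (simp add: VU)
  qed
  have Deq: "diag_of n d = V * A * U"
  proof -
    have "V * A * U = (V * U) * diag_of n d * (V * U)" unfolding AUV
      using U V D[of d] by (simp add: assoc_mult_mat[of _ n n _ n _ n])
    then show ?thesis unfolding VU using D[of d] by simp
  qed
  have herm: "mat_adjoint (V * A * U) = V * A * U"
  proof -
    have "mat_adjoint (V * A * U) = V * (A * U)"
      using mat_adjoint_mult[of "V * A" n n U n] mat_adjoint_mult[of V n n A n] U V A
      by (simp add: hA) (simp add: V_def mat_adjoint_adjoint)
    then show ?thesis using U V A by simp
  qed
  \<comment> \<open>The diagonal matrix equals \<open>V * A * U\<close> and is therefore its own
    adjoint, so its diagonal entries equal their conjugates.\<close>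
  have dreal: "d k = of_real (Re (d k))" if "k < n" for k
  proof -
    have "mat_adjoint (diag_of n d) $$ (k, k) = conjugate (diag_of n d $$ (k, k))"
      by (rule mat_adjoint_index) (use D[of d] that in auto)
    then have "diag_of n d $$ (k, k) = cnj (diag_of n d $$ (k, k))" using herm Deq by simp
    then show ?thesis using that by (simp add: diag_of_def complex_eq_iff)
  qed
  show thesis
  proof (rule that[of "\<lambda>k. Re (d k)" "\<lambda>i k. U $$ (i, k)"])
    fix i j assume ij: "i < n" "j < n"
    show "A $$ (i, j) = (\<Sum>k<n. of_real (Re (d k)) * U $$ (i, k) * cnj (U $$ (j, k)))"
      unfolding AUV UDV[OF ij] using dreal by (intro sum.cong) auto
    show "(\<Sum>k<n. U $$ (i, k) * cnj (U $$ (j, k))) = (if i = j then 1 else 0)" by (rule rows[OF ij])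
  next
    have "similar_mat_wit A (diag_of n d) U V"
      by (rule similar_mat_witI[OF UV VU AUV A D U V])
    then have "char_poly A = char_poly (diag_of n d)"
      by (intro char_poly_similar) (auto simp: similar_mat_def)
    also have "\<dots> = (\<Prod>a\<leftarrow>diag_mat (diag_of n d). [:- a, 1:])"
      by (rule char_poly_upper_triangular[OF D]) (auto simp: diag_of_def)
    also have "diag_mat (diag_of n d) = map (\<lambda>k. complex_of_real (Re (d k))) [0..<n]"
      unfolding diag_mat_def using dreal by (auto simp: diag_of_def)
    finally have cp: "char_poly A = (\<Prod>a\<leftarrow>map (\<lambda>k. complex_of_real (Re (d k))) [0..<n]. [:- a, 1:])" .
    have "proots (\<Prod>a\<leftarrow>xs. [:- a, 1:]) = mset xs" for xs :: "complex list"
    proof (induction xs)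
      case (Cons a xs)
      have "(\<Prod>a\<leftarrow>xs. [:- a, 1:]) \<noteq> 0" by (auto simp: prod_list_zero_iff)
      then have "proots ([:- a, 1:] * (\<Prod>a\<leftarrow>xs. [:- a, 1:])) = proots [:- a, 1:] + mset xs"
        using Cons by (subst proots_mult) auto
      then show ?case by simp
    qed simp
    then show "proots (char_poly A) = mset (map (\<lambda>k. complex_of_real (Re (d k))) [0..<n])" unfolding cp .
  next
    have "A * A = U * diag_of n d * (V * U) * diag_of n d * V" unfolding AUV
      using U V D[of d] by (simp add: assoc_mult_mat[of _ n n _ n _ n] mult_carrier_mat[of _ n n _ n])
    also have "\<dots> = U * (diag_of n d * diag_of n d) * V" unfolding VU
      using U V D[of d] by (simp add: assoc_mult_mat[of _ n n _ n _ n] mult_carrier_mat[of _ n n _ n])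
    finally have AA: "A * A = U * diag_of n (\<lambda>i. d i * d i) * V" unfolding DD .
    have "mat_trace (A * A) = (\<Sum>i<n. (A * A) $$ (i, i))" unfolding mat_trace_def using A by simp
    also have "\<dots> = (\<Sum>i<n. \<Sum>k<n. d k * d k * (U $$ (i, k) * cnj (U $$ (i, k))))"
      unfolding AA by (intro sum.cong refl) (simp add: UDV mult.assoc)
    also have "\<dots> = (\<Sum>k<n. d k * d k * (\<Sum>i<n. U $$ (i, k) * cnj (U $$ (i, k))))"
      by (subst sum.swap) (simp add: sum_distrib_left)
    also have "\<dots> = (\<Sum>k<n. d k * d k)" by (intro sum.cong refl) (simp add: cols)
    also have "\<dots> = of_real (\<Sum>k<n. (Re (d k))\<^sup>2)"
      unfolding of_real_sum power2_eq_square of_real_mult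
      by (intro sum.cong refl) (metis dreal lessThan_iff)
    finally show "mat_trace (A * A) = of_real (\<Sum>k<n. (Re (d k))\<^sup>2)" .
  qed
qed

section \<open>The uniform measure on the cube and its rate function\<close>

lemma finite_cube: "finite ({..<n::nat} \<rightarrow>\<^sub>E {-1, 1 :: real})"
  by (intro finite_PiE) auto

lemma card_cube: "card ({..<n::nat} \<rightarrow>\<^sub>E {-1, 1 :: real}) = 2 ^ n"
  by (simp add: card_PiE numeral_2_eq_2)

lemma cube_nonempty: "{..<n::nat} \<rightarrow>\<^sub>E {-1, 1 :: real} \<noteq> {}"
  by (simp add: PiE_eq_empty_iff)

lemma cube_measurable:
  "(\<lambda>x. x) \<in> measurable (uniform_count_measure ({..<n} \<rightarrow>\<^sub>E {-1, 1})) (euclid n)"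
proof -
  have "{..<n} \<rightarrow>\<^sub>E {-1, 1 :: real} \<subseteq> space (euclid n)"
    by (auto simp: space_PiM)
  then show ?thesis
    by (auto simp: measurable_def space_uniform_count_measure sets_uniform_count_measure)
qed

lemma integral_uniform_cube:
  assumes "g \<in> borel_measurable (euclid n)"
  shows "(\<integral>x. (g x :: real) \<partial>uniform_cube n) = (\<Sum>\<sigma>\<in>{..<n} \<rightarrow>\<^sub>E {-1, 1}. g \<sigma>) / 2 ^ n"
  unfolding uniform_cube_def
  by (subst integral_distr[OF cube_measurable assms])
     (simp add: integral_uniform_count_measure finite_cube card_cube)

lemma integrable_uniform_cube:
  assumes "g \<in> borel_measurable (euclid n)"
  shows "integrable (uniform_cube n) (g :: _ \<Rightarrow> real)"
  unfolding uniform_cube_def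
  by (subst integrable_distr_eq[OF cube_measurable assms])
     (simp add: uniform_count_measure_def integrable_point_measure_finite[OF finite_cube])

lemma log_laplace_uniform_cube:
  "log_laplace n (uniform_cube n) l =
     ereal (ln ((\<Sum>\<sigma>\<in>{..<n} \<rightarrow>\<^sub>E {-1, 1}. exp (dot n l \<sigma>)) / 2 ^ n))"
proof -
  have "(\<lambda>x. exp (dot n l x)) \<in> borel_measurable (euclid n)" unfolding dot_def by measurable
  then show ?thesis by (simp add: log_laplace_def integrable_uniform_cube integral_uniform_cube)
qed

lemma log_laplace_conj_ge:
  "ereal (dot n l x - ln ((\<Sum>\<sigma>\<in>{..<n} \<rightarrow>\<^sub>E {-1, 1}. exp (dot n l \<sigma>)) / 2 ^ n))
     \<le> log_laplace_conj n (uniform_cube n) x"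
proof -
  \<comment> \<open>The supremum defining the conjugate runs over extensional functions only;
    restricting \<open>l\<close> does not change the pairing.\<close>
  have eq: "dot n (restrict l {..<n}) y = dot n l y" for y by (simp add: dot_def)
  show ?thesis
    unfolding log_laplace_conj_def
    by (rule SUP_upper2[of "restrict l {..<n}"]) (auto simp: space_PiM log_laplace_uniform_cube eq)
qed

section \<open>Jensen's inequality, barycentres, and cutting the cube into cells\<close>

lemma jensen_exp:
  fixes p f :: "'a \<Rightarrow> real"
  assumes "finite S" "S \<noteq> {}" "\<And>s. s \<in> S \<Longrightarrow> p s \<ge> 0" "(\<Sum>s\<in>S. p s) = 1"
  shows "exp (\<Sum>s\<in>S. p s * f s) \<le> (\<Sum>s\<in>S. p s * exp (f s))"
  using convex_on_sum[OF assms(1,2) exp_convex assms(4,3), of f] by simp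

lemma dot_mean:
  assumes "finite D"
  shows "dot n l (\<lambda>i\<in>{..<n}. (\<Sum>\<sigma>\<in>D. \<sigma> i) / real (card D)) = (\<Sum>\<sigma>\<in>D. dot n l \<sigma>) / real (card D)"
proof -
  have "dot n l (\<lambda>i\<in>{..<n}. (\<Sum>\<sigma>\<in>D. \<sigma> i) / real (card D)) = (\<Sum>i<n. \<Sum>\<sigma>\<in>D. l i * \<sigma> i) / real (card D)"
    by (simp add: dot_def sum_distrib_left sum_divide_distrib)
  also have "(\<Sum>i<n. \<Sum>\<sigma>\<in>D. l i * \<sigma> i) = (\<Sum>\<sigma>\<in>D. dot n l \<sigma>)"
    unfolding dot_def by (rule sum.swap)
  finally show ?thesis .
qed

text \<open>Jensen for the uniform law on \<open>D\<close> bounds \<open>exp (dot n l x)\<close> by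
  an average over \<open>D\<close>. Extending this sum of positive terms to the whole cube costs the
  factor \<open>2 ^ n / card D\<close>, whatever \<open>l\<close> is.\<close>

lemma log_laplace_conj_mean_le:
  assumes D: "D \<subseteq> {..<n} \<rightarrow>\<^sub>E {-1, 1}" "D \<noteq> {}"
  shows "log_laplace_conj n (uniform_cube n) (\<lambda>i\<in>{..<n}. (\<Sum>\<sigma>\<in>D. \<sigma> i) / real (card D))
    \<le> ereal (ln (2 ^ n / real (card D)))"
proof -
  have fin: "finite D" using D finite_cube finite_subset by blast
  have c: "real (card D) > 0" using fin D by (simp add: card_gt_0_iff)
  define x where "x = (\<lambda>i\<in>{..<n}. (\<Sum>\<sigma>\<in>D. \<sigma> i) / real (card D))"
  have "dot n l x - ln ((\<Sum>\<sigma>\<in>{..<n} \<rightarrow>\<^sub>E {-1, 1}. exp (dot n l \<sigma>)) / 2 ^ n) \<le> ln (2 ^ n / real (card D))" for l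
  proof -
    let ?S = "\<Sum>\<sigma>\<in>{..<n} \<rightarrow>\<^sub>E {-1, 1}. exp (dot n l \<sigma>)"
    have S: "?S > 0" by (intro sum_pos finite_cube cube_nonempty) simp
    have "exp (dot n l x) = exp (\<Sum>\<sigma>\<in>D. (1 / real (card D)) * dot n l \<sigma>)"
      unfolding x_def dot_mean[OF fin] by (simp add: sum_divide_distrib)
    also have "\<dots> \<le> (\<Sum>\<sigma>\<in>D. (1 / real (card D)) * exp (dot n l \<sigma>))"
      using fin D c by (intro jensen_exp) auto
    also have "\<dots> = (\<Sum>\<sigma>\<in>D. exp (dot n l \<sigma>)) / real (card D)"
      by (simp add: sum_divide_distrib)
    also have "\<dots> \<le> ?S / real (card D)"
      by (intro divide_right_mono sum_mono2 finite_cube D) auto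
    finally have "dot n l x \<le> ln (?S / real (card D))"
      using S c by (simp add: ln_ge_iff)
    then show ?thesis using S c by (simp add: ln_div)
  qed
  then show ?thesis
    unfolding log_laplace_conj_def log_laplace_uniform_cube x_def by (intro SUP_least) simp
qed

text \<open>The map \<open>c\<close> is an arbitrary labelling whose fibres are the cells. On a cell
  \<open>D\<close> with barycentre \<open>x\<close>, each point weighs at most
  \<open>exp (f x + a)\<close>, while \<open>B\<close> and \<open>log_laplace_conj_mean_le\<close>
  bound \<open>exp (f x) * card D / 2 ^ n\<close> by \<open>exp B\<close>. The size of the cell thus
  cancels and only the number of cells remains.\<close>

lemma log_partition_le_of_cells:
  fixes f :: "(nat \<Rightarrow> real) \<Rightarrow> real" and c :: "(nat \<Rightarrow> real) \<Rightarrow> 'b"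
  assumes B: "\<And>x. x \<in> {..<n} \<rightarrow>\<^sub>E {-1..1} \<Longrightarrow> ereal (f x) - log_laplace_conj n (uniform_cube n) x \<le> ereal B"
    and var: "\<And>\<tau> D. \<tau> \<in> {..<n} \<rightarrow>\<^sub>E {-1, 1} \<Longrightarrow> D = {\<sigma> \<in> {..<n} \<rightarrow>\<^sub>E {-1, 1}. c \<sigma> = c \<tau>} \<Longrightarrow>
       f \<tau> \<le> f (\<lambda>i\<in>{..<n}. (\<Sum>\<sigma>\<in>D. \<sigma> i) / real (card D)) + a"
  shows "ln ((\<Sum>\<sigma>\<in>{..<n} \<rightarrow>\<^sub>E {-1, 1}. exp (f \<sigma>)) / 2 ^ n)
    \<le> ln (real (card (c ` ({..<n} \<rightarrow>\<^sub>E {-1, 1})))) + a + B"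
proof -
  let ?C = "{..<n} \<rightarrow>\<^sub>E {-1, 1 :: real}"
  define D where "D m = {\<sigma> \<in> ?C. c \<sigma> = m}" for m
  define x where "x m = (\<lambda>i\<in>{..<n}. (\<Sum>\<sigma>\<in>D m. \<sigma> i) / real (card (D m)))" for m
  have fin: "finite (D m)" for m unfolding D_def using finite_cube by auto
  have cell: "(\<Sum>\<sigma>\<in>D m. exp (f \<sigma>)) \<le> 2 ^ n * exp (a + B)" if m: "m \<in> c ` ?C" for m
  proof -
    have ne: "D m \<noteq> {}" using m by (auto simp: D_def)
    have cpos: "real (card (D m)) > 0" using fin ne by (simp add: card_gt_0_iff)
    have xm: "x m \<in> {..<n} \<rightarrow>\<^sub>E {-1..1}"
    proof
      fix i assume i: "i \<in> {..<n}"
      have b: "\<bar>\<sigma> i\<bar> \<le> 1" if "\<sigma> \<in> D m" for \<sigma>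
      proof -
        have "\<sigma> i \<in> {-1, 1}" using that i unfolding D_def by (blast dest: PiE_mem)
        then show ?thesis by auto
      qed
      have "\<bar>\<Sum>\<sigma>\<in>D m. \<sigma> i\<bar> \<le> (\<Sum>\<sigma>\<in>D m. \<bar>\<sigma> i\<bar>)" by (rule sum_abs)
      also have "\<dots> \<le> (\<Sum>\<sigma>\<in>D m. 1)" by (rule sum_mono) (rule b)
      finally have "\<bar>(\<Sum>\<sigma>\<in>D m. \<sigma> i) / real (card (D m))\<bar> \<le> 1" using cpos by (simp add: abs_divide)
      then have "- 1 \<le> (\<Sum>\<sigma>\<in>D m. \<sigma> i) / real (card (D m))" "(\<Sum>\<sigma>\<in>D m. \<sigma> i) / real (card (D m)) \<le> 1"
        unfolding abs_le_iff by linarith+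
      then show "x m i \<in> {-1..1}" using i by (simp add: x_def)
    qed (simp add: x_def)
    have "log_laplace_conj n (uniform_cube n) (x m) \<le> ereal (ln (2 ^ n / real (card (D m))))"
      unfolding x_def using ne by (intro log_laplace_conj_mean_le) (auto simp: D_def)
    then have "ereal (f (x m)) - ereal (ln (2 ^ n / real (card (D m)))) \<le> ereal B"
      by (intro order.trans[OF ereal_minus_mono B[OF xm]]) auto
    then have "f (x m) + a + ln (real (card (D m)) / 2 ^ n) \<le> a + B"
      using cpos by (simp add: ln_div)
    then have "exp (f (x m) + a + ln (real (card (D m)) / 2 ^ n)) \<le> exp (a + B)" by simp
    then have main: "exp (f (x m) + a) * (real (card (D m)) / 2 ^ n) \<le> exp (a + B)"
      using cpos unfolding exp_add[of "f (x m) + a" "ln _"] by simp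
    have "(\<Sum>\<sigma>\<in>D m. exp (f \<sigma>)) \<le> (\<Sum>\<sigma>\<in>D m. exp (f (x m) + a))"
    proof (rule sum_mono)
      fix \<sigma> assume "\<sigma> \<in> D m"
      then show "exp (f \<sigma>) \<le> exp (f (x m) + a)"
        using var[of \<sigma> "D m"] unfolding x_def by (simp add: D_def)
    qed
    also have "\<dots> = 2 ^ n * (exp (f (x m) + a) * (real (card (D m)) / 2 ^ n))" by simp
    also have "\<dots> \<le> 2 ^ n * exp (a + B)" by (intro mult_left_mono main) simp
    finally show ?thesis .
  qed
  have "(\<Sum>\<sigma>\<in>?C. exp (f \<sigma>)) = (\<Sum>m\<in>c ` ?C. \<Sum>\<sigma>\<in>D m. exp (f \<sigma>))"
    unfolding D_def by (rule sum.image_gen[OF finite_cube])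
  also have "\<dots> \<le> (\<Sum>m\<in>c ` ?C. 2 ^ n * exp (a + B))" by (intro sum_mono cell)
  finally have "(\<Sum>\<sigma>\<in>?C. exp (f \<sigma>)) / 2 ^ n \<le> real (card (c ` ?C)) * exp (a + B)"
    by (simp add: field_simps)
  moreover have pos: "(\<Sum>\<sigma>\<in>?C. exp (f \<sigma>)) / 2 ^ n > 0"
    by (intro divide_pos_pos sum_pos finite_cube cube_nonempty) auto
  ultimately have "ln ((\<Sum>\<sigma>\<in>?C. exp (f \<sigma>)) / 2 ^ n) \<le> ln (real (card (c ` ?C)) * exp (a + B))"
    by (subst ln_le_cancel_iff) linarith+
  also have "\<dots> = ln (real (card (c ` ?C))) + a + B"
  proof -
    have "card (c ` ?C) > 0" using finite_cube cube_nonempty by (simp add: card_gt_0_iff)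
    then show ?thesis by (simp add: ln_mult)
  qed
  finally show ?thesis .
qed

text \<open>Chernoff-type counting: every vector in \<open>M\<close> has weight at least 1 under
  \<open>exp (s * N)\<close> times the product of the \<open>w (m k)\<close>, and the total weight
  over a box factorises into geometric series. The free parameter \<open>s\<close> makes the bound
  subexponential in \<open>n\<close> when \<open>N\<close> is of order \<open>n\<close> and
  \<open>card L\<close> is of smaller order.\<close>

lemma card_int_vectors_le:
  fixes M :: "('k \<Rightarrow> int) set"
  assumes L: "finite L" and M: "M \<subseteq> L \<rightarrow>\<^sub>E UNIV" and s: "s > 0"
    and N: "\<And>m. m \<in> M \<Longrightarrow> (\<Sum>k\<in>L. real_of_int \<bar>m k\<bar>) \<le> N"
  shows "real (card M) \<le> exp (s * N) * (2 / (1 - exp (- s))) ^ card L"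
proof -
  \<comment> \<open>Truncation by \<open>nat\<close> matters only when \<open>N\<close> is negative,
    and then \<open>M\<close> is empty.\<close>
  define R where "R = nat \<lfloor>N\<rfloor>"
  define w where "w j = exp (- s * real_of_int \<bar>j\<bar>)" for j :: int
  have sub: "M \<subseteq> (\<Pi>\<^sub>E k\<in>L. {- int R..int R})"
  proof
    fix m assume m: "m \<in> M"
    show "m \<in> (\<Pi>\<^sub>E k\<in>L. {- int R..int R})"
    proof (rule PiE_I)
      fix k assume k: "k \<in> L"
      have "real_of_int \<bar>m k\<bar> \<le> (\<Sum>k\<in>L. real_of_int \<bar>m k\<bar>)" by (rule member_le_sum[OF k _ L]) auto
      then have "\<bar>m k\<bar> \<le> \<lfloor>N\<rfloor>" using N[OF m] by linarith
      moreover then have "0 \<le> \<lfloor>N\<rfloor>" by linarith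
      ultimately show "m k \<in> {- int R..int R}" by (auto simp: R_def)
    qed (use M m in auto)
  qed
  have finP: "finite (\<Pi>\<^sub>E k\<in>L. {- int R..int R})" by (intro finite_PiE L) auto
  have one: "(\<Sum>j\<in>{- int R..int R}. w j) \<le> 2 / (1 - exp (- s))"
  proof -
    have geo: "(\<Sum>i\<le>R. exp (- s) ^ i) \<le> 1 / (1 - exp (- s))"
    proof -
      have "(\<Sum>i\<le>R. exp (- s) ^ i) \<le> (\<Sum>i. exp (- s) ^ i)"
        using s by (intro sum_le_suminf summable_geometric) auto
      then show ?thesis using s by (simp add: suminf_geometric)
    qed
    have w: "w (int i) = exp (- s) ^ i" "w (- int i) = exp (- s) ^ i" for i
      by (simp_all add: w_def exp_of_nat_mult[symmetric] mult.commute)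
    \<comment> \<open>Splitting by sign counts 0 twice; this is harmless for an upper bound and
      leaves twice a geometric series.\<close>
    have "{- int R..int R} \<subseteq> int ` {..R} \<union> (\<lambda>i. - int i) ` {..R}"
    proof
      fix j assume "j \<in> {- int R..int R}"
      then show "j \<in> int ` {..R} \<union> (\<lambda>i. - int i) ` {..R}"
        by (cases "j \<ge> 0") (auto simp: image_iff intro: bexI[of _ "nat \<bar>j\<bar>"])
    qed
    then have "(\<Sum>j\<in>{- int R..int R}. w j) \<le> (\<Sum>j\<in>int ` {..R} \<union> (\<lambda>i. - int i) ` {..R}. w j)"
      by (intro sum_mono2) (auto simp: w_def)
    also have "\<dots> \<le> (\<Sum>j\<in>int ` {..R}. w j) + (\<Sum>j\<in>(\<lambda>i. - int i) ` {..R}. w j)"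
      using sum_nonneg[of "int ` {..R} \<inter> (\<lambda>i. - int i) ` {..R}" w]
      by (subst sum_Un) (auto simp: w_def)
    also have "\<dots> = 2 * (\<Sum>i\<le>R. exp (- s) ^ i)"
      by (subst (1 2) sum.reindex) (auto simp: inj_on_def w)
    finally show ?thesis using geo by simp
  qed
  have "real (card M) = (\<Sum>m\<in>M. 1)" by simp
  also have "\<dots> \<le> (\<Sum>m\<in>M. exp (s * N) * (\<Prod>k\<in>L. w (m k)))"
  proof (rule sum_mono)
    fix m assume m: "m \<in> M"
    have "(\<Prod>k\<in>L. w (m k)) = exp (- s * (\<Sum>k\<in>L. real_of_int \<bar>m k\<bar>))"
      using L by (simp add: w_def exp_sum sum_distrib_left)
    then have "exp (s * N) * (\<Prod>k\<in>L. w (m k)) = exp (s * (N - (\<Sum>k\<in>L. real_of_int \<bar>m k\<bar>)))"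
      by (simp add: exp_add[symmetric] algebra_simps)
    then show "1 \<le> exp (s * N) * (\<Prod>k\<in>L. w (m k))" using N[OF m] s by simp
  qed
  also have "\<dots> = exp (s * N) * (\<Sum>m\<in>M. \<Prod>k\<in>L. w (m k))" by (simp add: sum_distrib_left)
  also have "\<dots> \<le> exp (s * N) * (\<Sum>m\<in>(\<Pi>\<^sub>E k\<in>L. {- int R..int R}). \<Prod>k\<in>L. w (m k))"
    by (intro mult_left_mono sum_mono2 finP sub) (auto simp: w_def intro: prod_nonneg)
  also have "(\<Sum>m\<in>(\<Pi>\<^sub>E k\<in>L. {- int R..int R}). \<Prod>k\<in>L. w (m k)) = (\<Prod>k\<in>L. \<Sum>j\<in>{- int R..int R}. w j)"
    by (rule prod_sum_PiE[symmetric]) (auto simp: L)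
  also have "\<dots> = (\<Sum>j\<in>{- int R..int R}. w j) ^ card L" by simp
  also have "\<dots> \<le> (2 / (1 - exp (- s))) ^ card L"
    by (intro power_mono one sum_nonneg) (auto simp: w_def)
  finally show ?thesis by simp
qed

section \<open>Lower bound by tilting\<close>

lemma sum_cube_prod:
  fixes g :: "nat \<Rightarrow> real \<Rightarrow> real"
  shows "(\<Sum>\<sigma>\<in>{..<n} \<rightarrow>\<^sub>E {-1, 1}. \<Prod>i<n. g i (\<sigma> i)) = (\<Prod>i<n. g i (-1) + g i 1)"
  by (subst prod_sum_PiE[symmetric]) auto

text \<open>On the cube this is the law of independent signs with means \<open>y i\<close>, provided
  each \<open>y i\<close> lies in [-1, 1].\<close>

definition bias_weight :: "nat \<Rightarrow> (nat \<Rightarrow> real) \<Rightarrow> (nat \<Rightarrow> real) \<Rightarrow> real" where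
  "bias_weight n y \<sigma> = (\<Prod>i<n. (1 + y i * \<sigma> i) / 2)"

lemma bias_weight_sum: "(\<Sum>\<sigma>\<in>{..<n} \<rightarrow>\<^sub>E {-1, 1}. bias_weight n y \<sigma>) = 1"
  unfolding bias_weight_def
  by (subst sum_cube_prod[of "\<lambda>i s. (1 + y i * s) / 2" n]) (simp add: field_simps)

lemma bias_weight_mean:
  assumes "i < n"
  shows "(\<Sum>\<sigma>\<in>{..<n} \<rightarrow>\<^sub>E {-1, 1}. bias_weight n y \<sigma> * \<sigma> i) = y i"
proof -
  \<comment> \<open>Writing \<open>\<sigma> i\<close> as a product over \<open>k\<close> of factors
    equal to 1 away from \<open>i\<close> lets the sum over the cube factorise.\<close>
  have "bias_weight n y \<sigma> * \<sigma> i = (\<Prod>k<n. (1 + y k * \<sigma> k) / 2 * (if k = i then \<sigma> k else 1))" for \<sigma>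
    unfolding prod.distrib bias_weight_def using assms by simp
  then have "(\<Sum>\<sigma>\<in>{..<n} \<rightarrow>\<^sub>E {-1, 1}. bias_weight n y \<sigma> * \<sigma> i) =
      (\<Sum>\<sigma>\<in>{..<n} \<rightarrow>\<^sub>E {-1, 1}. \<Prod>k<n. (1 + y k * \<sigma> k) / 2 * (if k = i then \<sigma> k else 1))" by simp
  also have "\<dots> = (\<Prod>k<n. if k = i then y k else 1)"
    by (subst sum_cube_prod[of "\<lambda>k s. (1 + y k * s) / 2 * (if k = i then s else 1)" n], rule prod.cong[OF refl])
       (auto simp: field_simps)
  finally show ?thesis using assms by simp
qed

text \<open>Distinct coordinates are independent under the biased law. For \<open>i = j\<close> the
  sum would be 1 instead of the square of \<open>y i\<close>, and this is why the lower bound asks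
  for a vanishing diagonal.\<close>

lemma bias_weight_pair:
  assumes "i < n" "j < n" "i \<noteq> j"
  shows "(\<Sum>\<sigma>\<in>{..<n} \<rightarrow>\<^sub>E {-1, 1}. bias_weight n y \<sigma> * (\<sigma> i * \<sigma> j)) = y i * y j"
proof -
  have "bias_weight n y \<sigma> * (\<sigma> i * \<sigma> j) =
      (\<Prod>k<n. (1 + y k * \<sigma> k) / 2 * ((if k = i then \<sigma> k else 1) * (if k = j then \<sigma> k else 1)))" for \<sigma>
    unfolding prod.distrib bias_weight_def using assms by simp
  then have "(\<Sum>\<sigma>\<in>{..<n} \<rightarrow>\<^sub>E {-1, 1}. bias_weight n y \<sigma> * (\<sigma> i * \<sigma> j)) =
      (\<Sum>\<sigma>\<in>{..<n} \<rightarrow>\<^sub>E {-1, 1}. \<Prod>k<n. (1 + y k * \<sigma> k) / 2 * ((if k = i then \<sigma> k else 1) * (if k = j then \<sigma> k else 1)))" by simp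
  also have "\<dots> = (\<Prod>k<n. (if k = i then y k else 1) * (if k = j then y k else 1))"
    by (subst sum_cube_prod[of "\<lambda>k s. (1 + y k * s) / 2 * ((if k = i then s else 1) * (if k = j then s else 1))" n], rule prod.cong[OF refl])
       (use assms(3) in \<open>auto simp: field_simps\<close>)
  also have "\<dots> = y i * y j" unfolding prod.distrib using assms by simp
  finally show ?thesis .
qed

text \<open>A sign tilted by \<open>exp (h * s)\<close> has mean \<open>tanh h\<close>, so
  \<open>h = artanh y\<close> produces mean \<open>y\<close>. The denominator reflects cosh (artanh
  y) = 1 / sqrt (1 - y^2).\<close>

lemma exp_artanh_mult:
  assumes "\<bar>y\<bar> < 1" "s \<in> {-1, 1 :: real}"
  shows "exp (artanh y * s) = (1 + y * s) / sqrt (1 - y\<^sup>2)"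
proof -
  have pos: "1 + y > 0" "1 - y > 0" "1 + y * s > 0" using assms by auto
  have "artanh y * s = ln (1 + y * s) - ln (1 - y\<^sup>2) / 2"
  proof -
    have "1 - y\<^sup>2 = (1 + y) * (1 - y)" by (simp add: power2_eq_square algebra_simps)
    then have "ln (1 - y\<^sup>2) = ln (1 + y) + ln (1 - y)" using pos by (simp add: ln_mult)
    then show ?thesis using assms(2) pos by (auto simp: artanh_def ln_div field_simps)
  qed
  also have "\<dots> = ln ((1 + y * s) / sqrt (1 - y\<^sup>2))"
  proof -
    have "1 - y\<^sup>2 > 0" using assms by (simp add: abs_square_less_1)
    then show ?thesis using pos by (subst ln_divide_pos) (auto simp: ln_sqrt)
  qed
  finally show ?thesis using pos assms by (simp add: abs_square_less_1)
qed

text \<open>Tilting towards \<open>t x\<close> rather than \<open>x\<close> keeps \<open>artanh\<close> finite when \<open>x\<close> lies on the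
  boundary of the cube; homogeneity of the quadratic form makes the limit \<open>t \<rightarrow> 1\<close> harmless.\<close>

lemma mean_field_lower_bound:
  fixes a :: "nat \<Rightarrow> nat \<Rightarrow> real"
  assumes diag: "\<And>i. i < n \<Longrightarrow> a i i = 0"
    and x: "x \<in> {..<n} \<rightarrow>\<^sub>E {-1..1}"
    and f: "\<And>y. f y = (\<Sum>i<n. \<Sum>j<n. a i j * (y i * y j))"
  shows "ereal (f x) - log_laplace_conj n (uniform_cube n) x
    \<le> ereal (ln ((\<Sum>\<sigma>\<in>{..<n} \<rightarrow>\<^sub>E {-1, 1}. exp (f \<sigma>)) / 2 ^ n))"
proof -
  let ?C = "{..<n} \<rightarrow>\<^sub>E {-1, 1 :: real}"
  let ?I = "ln ((\<Sum>\<sigma>\<in>?C. exp (f \<sigma>)) / 2 ^ n)"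
  have Ipos: "(\<Sum>\<sigma>\<in>?C. exp (f \<sigma>)) / 2 ^ n > 0"
    by (intro divide_pos_pos sum_pos finite_cube cube_nonempty) auto
  have key: "ereal (t\<^sup>2 * f x) - log_laplace_conj n (uniform_cube n) x \<le> ereal ?I" if t: "0 < t" "t < 1" for t
  proof -
    define y where "y i = t * x i" for i
    have y1: "\<bar>y i\<bar> < 1" if "i < n" for i
    proof -
      have "\<bar>x i\<bar> \<le> 1" using x that by (force dest: PiE_mem)
      then have "t * \<bar>x i\<bar> \<le> t * 1" using t by (intro mult_left_mono) auto
      moreover have "\<bar>y i\<bar> = t * \<bar>x i\<bar>" using t by (simp add: y_def abs_mult)
      ultimately show ?thesis using t by linarith
    qed
    define l where "l i = artanh (y i)" for i
    \<comment> \<open>\<open>Z\<close> is the Laplace transform of the uniform measure at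
      \<open>l\<close>, a product of the values cosh (l i); this is the content of
      \<open>lap\<close> below.\<close>
    define Z where "Z = (\<Prod>i<n. 1 / sqrt (1 - (y i)\<^sup>2))"
    let ?p = "bias_weight n y"
    have Zpos: "Z > 0" unfolding Z_def using y1 by (intro prod_pos) (auto simp: abs_square_less_1)
    have p0: "?p \<sigma> \<ge> 0" if "\<sigma> \<in> ?C" for \<sigma>
      unfolding bias_weight_def
    proof (intro prod_nonneg)
      fix i assume i: "i \<in> {..<n}"
      then have "\<sigma> i \<in> {-1, 1}" using that by (blast dest: PiE_mem)
      then show "0 \<le> (1 + y i * \<sigma> i) / 2" using y1[of i] i by auto
    qed
    have tilt: "exp (dot n l \<sigma>) = 2 ^ n * ?p \<sigma> * Z" if "\<sigma> \<in> ?C" for \<sigma>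
    proof -
      have "exp (dot n l \<sigma>) = (\<Prod>i<n. 2 * ((1 + y i * \<sigma> i) / 2) * (1 / sqrt (1 - (y i)\<^sup>2)))"
        unfolding dot_def exp_sum[OF finite_lessThan]
      proof (intro prod.cong refl)
        fix i assume i: "i \<in> {..<n}"
        then have "\<sigma> i \<in> {-1, 1}" using that by (blast dest: PiE_mem)
        then show "exp (l i * \<sigma> i) = 2 * ((1 + y i * \<sigma> i) / 2) * (1 / sqrt (1 - (y i)\<^sup>2))"
        proof -
          have "2 * (z / 2) * (1 / w) = z / w" for z w :: real by simp
          then show ?thesis
            unfolding l_def using exp_artanh_mult[OF y1[of i], of "\<sigma> i"] i \<open>\<sigma> i \<in> {-1, 1}\<close>
            by (simp only: lessThan_iff)
        qed
      qed
      also have "\<dots> = 2 ^ n * ?p \<sigma> * Z"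
        unfolding prod.distrib bias_weight_def Z_def by simp
      finally show ?thesis .
    qed
    have lap: "(\<Sum>\<sigma>\<in>?C. exp (dot n l \<sigma>)) / 2 ^ n = Z"
    proof -
      have "(\<Sum>\<sigma>\<in>?C. exp (dot n l \<sigma>)) = (\<Sum>\<sigma>\<in>?C. ?p \<sigma>) * (2 ^ n * Z)"
        unfolding sum_distrib_right by (intro sum.cong refl) (simp add: tilt)
      then show ?thesis by (simp add: bias_weight_sum)
    qed
    \<comment> \<open>Diagonal terms vanish by \<open>diag\<close>, off-diagonal ones factorise by
      independence, and the factor \<open>t\<^sup>2\<close> comes from homogeneity.\<close>
    have meanf: "(\<Sum>\<sigma>\<in>?C. ?p \<sigma> * f \<sigma>) = t\<^sup>2 * f x"
    proof -
      have "(\<Sum>\<sigma>\<in>?C. ?p \<sigma> * f \<sigma>) = (\<Sum>\<sigma>\<in>?C. \<Sum>i<n. \<Sum>j<n. a i j * (?p \<sigma> * (\<sigma> i * \<sigma> j)))"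
        unfolding f sum_distrib_left by (intro sum.cong refl) (simp add: mult_ac)
      also have "\<dots> = (\<Sum>i<n. \<Sum>\<sigma>\<in>?C. \<Sum>j<n. a i j * (?p \<sigma> * (\<sigma> i * \<sigma> j)))"
        by (rule sum.swap)
      also have "\<dots> = (\<Sum>i<n. \<Sum>j<n. a i j * (\<Sum>\<sigma>\<in>?C. ?p \<sigma> * (\<sigma> i * \<sigma> j)))"
        unfolding sum_distrib_left by (intro sum.cong refl) (rule sum.swap)
      also have "\<dots> = (\<Sum>i<n. \<Sum>j<n. a i j * (y i * y j))"
      proof (intro sum.cong refl)
        fix i j assume "i \<in> {..<n}" "j \<in> {..<n}"
        then show "a i j * (\<Sum>\<sigma>\<in>?C. ?p \<sigma> * (\<sigma> i * \<sigma> j)) = a i j * (y i * y j)"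
          using diag[of i] by (cases "i = j") (simp_all add: bias_weight_pair)
      qed
      also have "\<dots> = t\<^sup>2 * f x"
        unfolding f sum_distrib_left by (intro sum.cong refl) (simp add: y_def power2_eq_square mult_ac)
      finally show ?thesis .
    qed
    have meanl: "(\<Sum>\<sigma>\<in>?C. ?p \<sigma> * dot n l \<sigma>) = t * dot n l x"
    proof -
      have "(\<Sum>\<sigma>\<in>?C. ?p \<sigma> * dot n l \<sigma>) = (\<Sum>\<sigma>\<in>?C. \<Sum>i<n. l i * (?p \<sigma> * \<sigma> i))"
        unfolding dot_def sum_distrib_left by (intro sum.cong refl) (simp add: mult_ac)
      also have "\<dots> = (\<Sum>i<n. l i * (\<Sum>\<sigma>\<in>?C. ?p \<sigma> * \<sigma> i))"
        unfolding sum_distrib_left by (rule sum.swap)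
      also have "\<dots> = (\<Sum>i<n. l i * y i)" by (intro sum.cong refl) (simp add: bias_weight_mean)
      also have "\<dots> = t * dot n l x"
        unfolding dot_def sum_distrib_left by (intro sum.cong refl) (simp add: y_def mult_ac)
      finally show ?thesis .
    qed
    \<comment> \<open>Each \<open>artanh (t * x i)\<close> has the sign of \<open>x i\<close>.
      Nonnegativity allows \<open>t * dot n l x\<close> to be enlarged to \<open>dot n l x\<close>,
      so that the conjugate enters at \<open>x\<close> itself and not at \<open>t x\<close>.\<close>
    have lx: "dot n l x \<ge> 0"
      unfolding dot_def
    proof (intro sum_nonneg)
      fix i assume i: "i \<in> {..<n}"
      show "l i * x i \<ge> 0"
      proof (cases "x i \<ge> 0")
        case True
        then have "0 \<le> y i" using t by (simp add: y_def)
        then have "artanh (y i) \<ge> 0" using y1[of i] i by (auto simp: artanh_def)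
        then show ?thesis using True by (simp add: l_def)
      next
        case False
        then have "y i \<le> 0" using t by (simp add: y_def mult_le_0_iff)
        then have "artanh (y i) \<le> 0" using y1[of i] i by (auto simp: artanh_def)
        then show ?thesis using False by (simp add: l_def mult_nonpos_nonpos)
      qed
    qed
    \<comment> \<open>Jensen under the biased law: the weight \<open>?p \<sigma>\<close> cancels
      \<open>exp (dot n l \<sigma>)\<close> up to the constant \<open>2 ^ n * Z\<close>, and the
      untilted sum of \<open>exp (f \<sigma>)\<close> reappears.\<close>
    have "exp (t\<^sup>2 * f x - t * dot n l x) = exp (\<Sum>\<sigma>\<in>?C. ?p \<sigma> * (f \<sigma> - dot n l \<sigma>))"
      by (simp add: right_diff_distrib sum_subtractf meanf meanl)
    also have "\<dots> \<le> (\<Sum>\<sigma>\<in>?C. ?p \<sigma> * exp (f \<sigma> - dot n l \<sigma>))"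
      by (intro jensen_exp finite_cube cube_nonempty p0 bias_weight_sum)
    also have "\<dots> = (\<Sum>\<sigma>\<in>?C. exp (f \<sigma>) / (2 ^ n * Z))"
    proof (intro sum.cong refl)
      fix \<sigma> assume s: "\<sigma> \<in> ?C"
      show "?p \<sigma> * exp (f \<sigma> - dot n l \<sigma>) = exp (f \<sigma>) / (2 ^ n * Z)"
      proof -
        have "?p \<sigma> = exp (dot n l \<sigma>) / (2 ^ n * Z)" using tilt[OF s] Zpos by simp
        then show ?thesis by (simp add: exp_diff)
      qed
    qed
    also have "\<dots> = (\<Sum>\<sigma>\<in>?C. exp (f \<sigma>)) / 2 ^ n / Z" by (simp add: sum_divide_distrib)
    finally have "t\<^sup>2 * f x - t * dot n l x \<le> ln ((\<Sum>\<sigma>\<in>?C. exp (f \<sigma>)) / 2 ^ n / Z)"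
      by (subst ln_ge_iff) (rule divide_pos_pos[OF Ipos Zpos])
    also have "\<dots> = ?I - ln Z" using Ipos Zpos by (subst ln_divide_pos) auto
    finally have 1: "t\<^sup>2 * f x - t * dot n l x \<le> ?I - ln Z" .
    have "t * dot n l x \<le> dot n l x" using lx t by (simp add: mult_left_le_one_le)
    with 1 have 2: "t\<^sup>2 * f x - (dot n l x - ln Z) \<le> ?I" by linarith
    have "ereal (dot n l x - ln Z) \<le> log_laplace_conj n (uniform_cube n) x"
      using log_laplace_conj_ge[of n l x] unfolding lap .
    then have "ereal (t\<^sup>2 * f x) - log_laplace_conj n (uniform_cube n) x \<le> ereal (t\<^sup>2 * f x) - ereal (dot n l x - ln Z)"
      by (intro ereal_minus_mono) auto
    also have "\<dots> \<le> ereal ?I" using 2 by simp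
    finally show ?thesis .
  qed
  show ?thesis
  \<comment> \<open>For a finite conjugate, \<open>t\<close> tends to 1 from below in
    \<open>key\<close>. The value \<infinity> makes the left side -\<infinity>, and -\<infinity> is
    excluded by testing with \<open>l = 0\<close>.\<close>
  proof (cases "log_laplace_conj n (uniform_cube n) x")
    case (real c)
    have "\<forall>\<^sub>F t in at_left 1. t\<^sup>2 * f x - c \<le> ?I"
      unfolding eventually_at_left_field using key real by (intro exI[of _ 0]) auto
    moreover have "((\<lambda>t. t\<^sup>2 * f x - c) \<longlongrightarrow> 1\<^sup>2 * f x - c) (at_left 1)"
      by (intro tendsto_intros)
    ultimately have "1\<^sup>2 * f x - c \<le> ?I"
      by (intro tendsto_upperbound[of _ _ "at_left 1"]) auto
    then show ?thesis using real by simp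
  next
    case PInf
    then show ?thesis by simp
  next
    case MInf
    then show ?thesis using log_laplace_conj_ge[of n "\<lambda>_. 0" x] by simp
  qed
qed

section \<open>Upper bound by cells\<close>

text \<open>For small \<open>lam\<close> the two squares are bounded separately. For close
  \<open>t\<close> and \<open>x\<close> the difference factors as (t - x)(t + x), and the products
  of \<open>lam\<close> with \<open>t\<close> and \<open>x\<close> are handled by the
  arithmetic-geometric mean inequality. Adding both bounds gives one estimate that can be summed
  over all eigenvalues.\<close>

lemma quadratic_diff_le:
  fixes lam t x \<epsilon> \<delta> :: real
  assumes "\<epsilon> \<ge> 0" "\<delta> \<ge> 0" "\<bar>lam\<bar> \<le> \<epsilon> \<or> \<bar>t - x\<bar> \<le> \<delta>"
  shows "lam * (t\<^sup>2 - x\<^sup>2) \<le> \<epsilon> * (t\<^sup>2 + x\<^sup>2) + \<delta> * (lam\<^sup>2 + t\<^sup>2 + x\<^sup>2)"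
  using assms(3)
proof
  assume "\<bar>lam\<bar> \<le> \<epsilon>"
  have "lam * (t\<^sup>2 - x\<^sup>2) \<le> \<bar>lam\<bar> * \<bar>t\<^sup>2 - x\<^sup>2\<bar>" by (metis abs_ge_self abs_mult)
  moreover have "\<bar>t\<^sup>2 - x\<^sup>2\<bar> \<le> t\<^sup>2 + x\<^sup>2" using zero_le_power2[of t] zero_le_power2[of x] by linarith
  then have "\<bar>lam\<bar> * \<bar>t\<^sup>2 - x\<^sup>2\<bar> \<le> \<epsilon> * (t\<^sup>2 + x\<^sup>2)" using \<open>\<bar>lam\<bar> \<le> \<epsilon>\<close> by (intro mult_mono) auto
  moreover have "\<delta> * (lam\<^sup>2 + t\<^sup>2 + x\<^sup>2) \<ge> 0" using assms(2) by simp
  ultimately show ?thesis by linarith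
next
  assume d: "\<bar>t - x\<bar> \<le> \<delta>"
  have am: "\<bar>lam\<bar> * \<bar>z\<bar> \<le> (lam\<^sup>2 + z\<^sup>2) / 2" for z
    using sum_squares_bound[of "\<bar>lam\<bar>" "\<bar>z\<bar>"] by simp
  have "lam * (t\<^sup>2 - x\<^sup>2) = (t - x) * (lam * (t + x))" by (simp add: power2_eq_square algebra_simps)
  also have "\<dots> \<le> \<bar>t - x\<bar> * (\<bar>lam\<bar> * \<bar>t + x\<bar>)" by (metis abs_ge_self abs_mult)
  also have "\<dots> \<le> \<delta> * (lam\<^sup>2 + t\<^sup>2 + x\<^sup>2)"
  proof (intro mult_mono d)
    have "\<bar>lam\<bar> * \<bar>t + x\<bar> \<le> \<bar>lam\<bar> * (\<bar>t\<bar> + \<bar>x\<bar>)" by (intro mult_left_mono) auto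
    also have "\<dots> \<le> (lam\<^sup>2 + t\<^sup>2) / 2 + (lam\<^sup>2 + x\<^sup>2) / 2"
      unfolding distrib_left by (intro add_mono am)
    also have "\<dots> \<le> lam\<^sup>2 + t\<^sup>2 + x\<^sup>2"
      using zero_le_power2[of t] zero_le_power2[of x] by (simp add: field_simps)
    finally show "\<bar>lam\<bar> * \<bar>t + x\<bar> \<le> lam\<^sup>2 + t\<^sup>2 + x\<^sup>2" .
  qed (use assms(2) in auto)
  also have "\<dots> \<le> \<epsilon> * (t\<^sup>2 + x\<^sup>2) + \<delta> * (lam\<^sup>2 + t\<^sup>2 + x\<^sup>2)" using assms(1) by simp
  finally show ?thesis .
qed

text \<open>Up to \<open>2 * n\<close> functionals are allowed, because a complex eigenvector gives
  two real ones; these need not be orthogonal, so only Bessel's inequality is assumed. The terms in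
  \<open>\<epsilon>\<close> and \<open>\<delta>\<close> measure the oscillation on a cell, the
  remaining ones the logarithm of the number of cells.\<close>

lemma mean_field_upper_bound:
  fixes v :: "'k \<Rightarrow> nat \<Rightarrow> real" and lam :: "'k \<Rightarrow> real"
  assumes K: "finite K" "card K \<le> 2 * n"
    and bessel: "\<And>x. (\<Sum>k\<in>K. (dot n (v k) x)\<^sup>2) \<le> (\<Sum>i<n. (x i)\<^sup>2)"
    and lam2: "(\<Sum>k\<in>K. (lam k)\<^sup>2) \<le> C * real n"
    and f: "\<And>x. f x = (\<Sum>k\<in>K. lam k * (dot n (v k) x)\<^sup>2)"
    and B: "\<And>x. x \<in> {..<n} \<rightarrow>\<^sub>E {-1..1} \<Longrightarrow> ereal (f x) - log_laplace_conj n (uniform_cube n) x \<le> ereal B"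
    and pos: "\<epsilon> > 0" "\<delta> > 0" "s > 0"
  shows "ln ((\<Sum>\<sigma>\<in>{..<n} \<rightarrow>\<^sub>E {-1, 1}. exp (f \<sigma>)) / 2 ^ n) \<le> B +
    real n * (2 * \<epsilon> + \<delta> * (C + 2) + s * (3 / \<delta> + 2)) +
    real (card {k\<in>K. \<bar>lam k\<bar> > \<epsilon>}) * ln (2 / (1 - exp (- s)))"
proof -
  let ?C = "{..<n} \<rightarrow>\<^sub>E {-1, 1 :: real}"
  define L where "L = {k\<in>K. \<bar>lam k\<bar> > \<epsilon>}"
  define T where "T k x = dot n (v k) x" for k x
  define c where "c \<sigma> = (\<lambda>k\<in>L. \<lfloor>T k \<sigma> / \<delta>\<rfloor>)" for \<sigma>
  \<comment> \<open>This is \<open>quadratic_diff_le\<close> summed over \<open>K\<close>: Bessel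
    bounds the squares at a point and at the barycentre by \<open>n\<close> each, and the squares of
    \<open>lam\<close> sum to at most \<open>C * n\<close>.\<close>
  define a where "a = real n * (2 * \<epsilon> + \<delta> * (C + 2))"
  have LK: "L \<subseteq> K" "finite L" using K by (auto simp: L_def)
  have "card L \<le> 2 * n" using card_mono[OF K(1) LK(1)] K(2) by linarith
  then have cL: "real (card L) \<le> 2 * real n" by linarith
  have bes: "(\<Sum>k\<in>K. (T k x)\<^sup>2) \<le> real n" if "\<And>i. i < n \<Longrightarrow> \<bar>x i\<bar> \<le> 1" for x
  proof -
    have "(\<Sum>i<n. (x i)\<^sup>2) \<le> (\<Sum>i<n. 1)" using that by (intro sum_mono) (simp add: abs_square_le_1)
    then show ?thesis using bessel[of x] by (simp add: T_def)
  qed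
  have cube1: "\<bar>\<sigma> i\<bar> \<le> 1" if "\<sigma> \<in> ?C" "i < n" for \<sigma> i
  proof -
    have "\<sigma> i \<in> {-1, 1}" using that by (blast dest: PiE_mem)
    then show ?thesis by auto
  qed
  have "ln ((\<Sum>\<sigma>\<in>?C. exp (f \<sigma>)) / 2 ^ n) \<le> ln (real (card (c ` ?C))) + a + B"
  proof (rule log_partition_le_of_cells[OF B])
    fix \<tau> D assume \<tau>: "\<tau> \<in> ?C" and D: "D = {\<sigma> \<in> ?C. c \<sigma> = c \<tau>}"
    define x where "x = (\<lambda>i\<in>{..<n}. (\<Sum>\<sigma>\<in>D. \<sigma> i) / real (card D))"
    have fin: "finite D" unfolding D using finite_cube[of n] by auto
    have "\<tau> \<in> D" using \<tau> D by auto
    then have cpos: "real (card D) > 0" using fin by (auto simp: card_gt_0_iff)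
    have x1: "\<bar>x i\<bar> \<le> 1" if i: "i < n" for i
    proof -
      have "\<bar>\<Sum>\<sigma>\<in>D. \<sigma> i\<bar> \<le> (\<Sum>\<sigma>\<in>D. \<bar>\<sigma> i\<bar>)" by (rule sum_abs)
      also have "\<dots> \<le> (\<Sum>\<sigma>\<in>D. 1)" by (rule sum_mono) (use cube1 i in \<open>auto simp: D\<close>)
      finally show ?thesis using cpos i by (simp add: x_def)
    qed
    \<comment> \<open>On a cell, \<open>T k\<close> stays in one closed interval of length
      \<open>\<delta>\<close>; by linearity its value at the barycentre is an average and lies there
      too.\<close>
    have close: "\<bar>T k \<tau> - T k x\<bar> \<le> \<delta>" if k: "k \<in> L" for k
    proof -
      define m where "m = real_of_int \<lfloor>T k \<tau> / \<delta>\<rfloor>"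
      have cell: "\<delta> * m \<le> T k \<sigma>" "T k \<sigma> \<le> \<delta> * m + \<delta>" if "\<sigma> \<in> D" for \<sigma>
      proof -
        have "c \<sigma> k = c \<tau> k" using that D by simp
        then have "m = real_of_int \<lfloor>T k \<sigma> / \<delta>\<rfloor>" using k by (simp add: c_def m_def)
        then have "m \<le> T k \<sigma> / \<delta>" "T k \<sigma> / \<delta> \<le> m + 1" by linarith+
        then show "\<delta> * m \<le> T k \<sigma>" "T k \<sigma> \<le> \<delta> * m + \<delta>" using pos by (simp_all add: field_simps)
      qed
      have Tx: "T k x = (\<Sum>\<sigma>\<in>D. T k \<sigma>) / real (card D)"
        unfolding T_def x_def by (rule dot_mean[OF fin])
      have "(\<Sum>\<sigma>\<in>D. \<delta> * m) \<le> (\<Sum>\<sigma>\<in>D. T k \<sigma>)" "(\<Sum>\<sigma>\<in>D. T k \<sigma>) \<le> (\<Sum>\<sigma>\<in>D. \<delta> * m + \<delta>)"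
        by (rule sum_mono[OF cell(1)], assumption, rule sum_mono[OF cell(2)], assumption)
      then have "\<delta> * m \<le> T k x" "T k x \<le> \<delta> * m + \<delta>"
        unfolding Tx using cpos by (simp_all add: field_simps)
      then show ?thesis using cell[OF \<open>\<tau> \<in> D\<close>] by linarith
    qed
    have "f \<tau> - f x = (\<Sum>k\<in>K. lam k * ((T k \<tau>)\<^sup>2 - (T k x)\<^sup>2))"
      by (simp add: f T_def right_diff_distrib sum_subtractf)
    also have "\<dots> \<le> (\<Sum>k\<in>K. \<epsilon> * ((T k \<tau>)\<^sup>2 + (T k x)\<^sup>2) + \<delta> * ((lam k)\<^sup>2 + (T k \<tau>)\<^sup>2 + (T k x)\<^sup>2))"
    proof (rule sum_mono, rule quadratic_diff_le)
      fix k assume "k \<in> K"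
      then show "\<bar>lam k\<bar> \<le> \<epsilon> \<or> \<bar>T k \<tau> - T k x\<bar> \<le> \<delta>" using close[of k] by (cases "k \<in> L") (auto simp: L_def)
    qed (use pos in auto)
    also have "\<dots> = \<epsilon> * ((\<Sum>k\<in>K. (T k \<tau>)\<^sup>2) + (\<Sum>k\<in>K. (T k x)\<^sup>2)) +
        \<delta> * ((\<Sum>k\<in>K. (lam k)\<^sup>2) + (\<Sum>k\<in>K. (T k \<tau>)\<^sup>2) + (\<Sum>k\<in>K. (T k x)\<^sup>2))"
      by (simp only: sum.distrib sum_distrib_left[symmetric])
    also have "\<dots> \<le> \<epsilon> * (real n + real n) + \<delta> * (C * real n + real n + real n)"
      using pos bes[of \<tau>] bes[of x] lam2 cube1[OF \<tau>] x1
      by (intro add_mono mult_left_mono) auto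
    also have "\<dots> = a" by (simp add: a_def algebra_simps)
    finally show "f \<tau> \<le> f x + a" by linarith
  qed
  moreover have "ln (real (card (c ` ?C))) \<le> s * (real n * (3 / \<delta> + 2)) + real (card L) * ln (2 / (1 - exp (- s)))"
  proof -
    \<comment> \<open>Rounding gives at most |T|/\<delta> + 1, and |T| is at most T^2 + 1. With
      squares summing to at most \<open>n\<close> and \<open>card L\<close> at most
      \<open>2 * n\<close>, the total is n/\<delta> + 2n(1/\<delta> + 1), which is
      \<open>N\<close>.\<close>
    define N where "N = real n * (3 / \<delta> + 2)"
    have q: "2 / (1 - exp (- s)) > 0" using pos by simp
    have "real (card (c ` ?C)) \<le> exp (s * N) * (2 / (1 - exp (- s))) ^ card L"
    proof (rule card_int_vectors_le[OF LK(2) _ pos(3)])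
      fix m assume "m \<in> c ` ?C"
      then obtain \<sigma> where s: "\<sigma> \<in> ?C" and m: "m = c \<sigma>" by blast
      have "(\<Sum>k\<in>L. real_of_int \<bar>m k\<bar>) \<le> (\<Sum>k\<in>L. ((T k \<sigma>)\<^sup>2 + 1) / \<delta> + 1)"
      proof (rule sum_mono)
        fix k assume k: "k \<in> L"
        have "real_of_int \<bar>m k\<bar> \<le> \<bar>T k \<sigma> / \<delta>\<bar> + 1" 
        proof -
          have "real_of_int \<bar>\<lfloor>r\<rfloor>\<bar> \<le> \<bar>r\<bar> + 1" for r :: real by linarith
          then show ?thesis using k by (simp only: m c_def restrict_apply if_True)
        qed
        also have "\<bar>T k \<sigma> / \<delta>\<bar> = \<bar>T k \<sigma>\<bar> / \<delta>" using pos by (simp add: abs_divide)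
        also have "\<bar>T k \<sigma>\<bar> \<le> (T k \<sigma>)\<^sup>2 + 1"
          using sum_squares_bound[of "\<bar>T k \<sigma>\<bar>" 1] abs_ge_zero[of "T k \<sigma>"] by simp
        finally show "real_of_int \<bar>m k\<bar> \<le> ((T k \<sigma>)\<^sup>2 + 1) / \<delta> + 1"
          using pos by (simp add: divide_right_mono)
      qed
      also have "\<dots> = (\<Sum>k\<in>L. (T k \<sigma>)\<^sup>2) / \<delta> + real (card L) * (1 / \<delta> + 1)"
        by (simp add: sum.distrib sum_divide_distrib add_divide_distrib algebra_simps)
      also have "\<dots> \<le> real n / \<delta> + 2 * real n * (1 / \<delta> + 1)"
      proof (intro add_mono divide_right_mono mult_right_mono cL)
        have "(\<Sum>k\<in>L. (T k \<sigma>)\<^sup>2) \<le> (\<Sum>k\<in>K. (T k \<sigma>)\<^sup>2)" by (intro sum_mono2 K LK) auto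
        also have "\<dots> \<le> real n" using cube1[OF s] by (rule bes)
        finally show "(\<Sum>k\<in>L. (T k \<sigma>)\<^sup>2) \<le> real n" .
      qed (use pos in auto)
      also have "\<dots> = N" by (simp add: N_def algebra_simps)
      finally show "(\<Sum>k\<in>L. real_of_int \<bar>m k\<bar>) \<le> N" .
    qed (auto simp: c_def)
    moreover have "real (card (c ` ?C)) > 0" using finite_cube[of n] cube_nonempty[of n] by (simp add: card_gt_0_iff)
    ultimately have "ln (real (card (c ` ?C))) \<le> ln (exp (s * N) * (2 / (1 - exp (- s))) ^ card L)"
      by (subst ln_le_cancel_iff) linarith+
    also have "\<dots> = s * N + real (card L) * ln (2 / (1 - exp (- s)))"
      using q by (subst ln_mult) (auto simp: ln_realpow simp del: ln_div)
    finally show ?thesis by (simp add: N_def)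
  qed
  ultimately show ?thesis by (simp add: a_def L_def algebra_simps)
qed

section \<open>From complex eigenvectors to real functionals, and the two bounds for a Hermitian
  matrix\<close>

lemma hermitian_quad_form_real_functionals:
  fixes x :: "nat \<Rightarrow> real" and c :: "nat \<Rightarrow> real" and u :: "nat \<Rightarrow> nat \<Rightarrow> complex"
  shows "(\<Sum>i<n. \<Sum>j<n. complex_of_real (x i) * (\<Sum>k<n. of_real (c k) * u i k * cnj (u j k)) * of_real (x j)) =
    of_real (\<Sum>k<n. c k * ((dot n (\<lambda>i. Re (u i k)) x)\<^sup>2 + (dot n (\<lambda>i. Im (u i k)) x)\<^sup>2))"
proof -
  \<comment> \<open>The form is the sum of \<open>c k\<close> times the squared modulus of
    \<open>z k\<close>; since \<open>x\<close> is real, the real and imaginary parts of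
    \<open>z k\<close> are real linear functionals of \<open>x\<close>.\<close>
  define z where "z k = (\<Sum>i<n. of_real (x i) * u i k)" for k
  have Re: "Re (z k) = dot n (\<lambda>i. Re (u i k)) x" and Im: "Im (z k) = dot n (\<lambda>i. Im (u i k)) x" for k
    by (simp_all add: z_def dot_def mult.commute)
  have "(\<Sum>i<n. \<Sum>j<n. complex_of_real (x i) * (\<Sum>k<n. of_real (c k) * u i k * cnj (u j k)) * of_real (x j))
      = (\<Sum>i<n. \<Sum>j<n. \<Sum>k<n. of_real (c k) * ((of_real (x i) * u i k) * (of_real (x j) * cnj (u j k))))"
    by (simp add: sum_distrib_left sum_distrib_right mult_ac)
  also have "\<dots> = (\<Sum>i<n. \<Sum>k<n. \<Sum>j<n. of_real (c k) * ((of_real (x i) * u i k) * (of_real (x j) * cnj (u j k))))"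
    by (rule sum.cong[OF refl], rule sum.swap)
  also have "\<dots> = (\<Sum>k<n. \<Sum>i<n. \<Sum>j<n. of_real (c k) * ((of_real (x i) * u i k) * (of_real (x j) * cnj (u j k))))"
    by (rule sum.swap)
  also have "\<dots> = (\<Sum>k<n. of_real (c k) * (z k * cnj (z k)))"
    unfolding z_def cnj_sum complex_cnj_mult complex_cnj_complex_of_real sum_product
    unfolding sum_distrib_left by (rule refl)
  also have "\<dots> = (\<Sum>k<n. of_real (c k * ((Re (z k))\<^sup>2 + (Im (z k))\<^sup>2)))"
    by (simp add: complex_mult_cnj)
  finally show ?thesis by (simp add: Re Im)
qed

definition large_eigenvalues :: "real \<Rightarrow> complex mat \<Rightarrow> nat" where
  "large_eigenvalues \<epsilon> A = size {#z \<in># proots (char_poly A). \<epsilon> < \<bar>Re z\<bar>#}"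

text \<open>A single \<open>B\<close> serves all \<open>C\<close>, \<open>\<epsilon>\<close>,
  \<open>\<delta>\<close>, \<open>s\<close>, so these may be chosen afterwards. The factors 2 at
  \<open>C\<close> and at \<open>large_eigenvalues\<close> arise because each eigenvalue carries two
  real functionals.\<close>

lemma mean_field_approximation:
  fixes n :: nat and A :: "complex mat"
  defines "I \<equiv> ln (\<integral>\<sigma>. exp (quad_form n A \<sigma>) \<partial>uniform_cube n)"
    and "S \<equiv> SUP x\<in>{..<n} \<rightarrow>\<^sub>E {-1..1}. ereal (quad_form n A x) - log_laplace_conj n (uniform_cube n) x"
  assumes h: "hermitian_mat n A"
    and diag: "\<And>i. i < n \<Longrightarrow> A $$ (i, i) = 0"
  obtains B where "S = ereal B" "B \<le> I"
    "\<And>C \<epsilon> \<delta> s. Re (mat_trace (A * A)) \<le> C * real n \<Longrightarrow> \<epsilon> > 0 \<Longrightarrow> \<delta> > 0 \<Longrightarrow> s > 0 \<Longrightarrow>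
      I \<le> B + real n * (2 * \<epsilon> + \<delta> * (2 * C + 2) + s * (3 / \<delta> + 2)) +
        2 * real (large_eigenvalues \<epsilon> A) * ln (2 / (1 - exp (- s)))"
proof -
  let ?f = "quad_form n A"
  let ?C = "{..<n} \<rightarrow>\<^sub>E {-1, 1 :: real}"
  have "(\<lambda>\<sigma>. exp (?f \<sigma>)) \<in> borel_measurable (euclid n)"
    unfolding quad_form_def by measurable
  then have I: "I = ln ((\<Sum>\<sigma>\<in>?C. exp (?f \<sigma>)) / 2 ^ n)"
    unfolding I_def by (simp add: integral_uniform_cube)
  have lower: "ereal (?f x) - log_laplace_conj n (uniform_cube n) x \<le> ereal I" if "x \<in> {..<n} \<rightarrow>\<^sub>E {-1..1}" for x
    unfolding I
  proof (rule mean_field_lower_bound[where a = "\<lambda>i j. Re (A $$ (i, j))", OF _ that])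
    show "Re (A $$ (i, i)) = 0" if "i < n" for i using diag[OF that] by simp
    show "?f y = (\<Sum>i<n. \<Sum>j<n. Re (A $$ (i, j)) * (y i * y j))" for y
      unfolding quad_form_def by (simp add: mult_ac)
  qed
  have "S \<le> ereal I" unfolding S_def by (intro SUP_least lower)
  moreover have "S \<noteq> -\<infinity>"
  proof -
    \<comment> \<open>A vertex is the barycentre of its own singleton, so the rate function there is
      at most \<open>ln (2 ^ n)\<close>, which keeps the supremum above -\<infinity>.\<close>
    define \<tau> where "\<tau> = (\<lambda>i\<in>{..<n}. 1 :: real)"
    have "log_laplace_conj n (uniform_cube n) (\<lambda>i\<in>{..<n}. (\<Sum>\<sigma>\<in>{\<tau>}. \<sigma> i) / real (card {\<tau>}))
        \<le> ereal (ln (2 ^ n / real (card {\<tau>})))"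
      by (rule log_laplace_conj_mean_le) (auto simp: \<tau>_def)
    moreover have "(\<lambda>i\<in>{..<n}. (\<Sum>\<sigma>\<in>{\<tau>}. \<sigma> i) / real (card {\<tau>})) = \<tau>"
      by (rule ext) (simp add: \<tau>_def restrict_def)
    ultimately have "log_laplace_conj n (uniform_cube n) \<tau> \<le> ereal (ln (2 ^ n))" by simp
    then have "ereal (?f \<tau>) - ereal (ln (2 ^ n)) \<le> ereal (?f \<tau>) - log_laplace_conj n (uniform_cube n) \<tau>"
      by (intro ereal_minus_mono) auto
    also have "\<dots> \<le> S" unfolding S_def by (rule SUP_upper) (auto simp: \<tau>_def split: if_splits)
    finally show ?thesis by auto
  qed
  ultimately obtain B where B: "S = ereal B" by (cases S) auto
  show thesis
  proof (rule that[OF B])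
    show "B \<le> I" using \<open>S \<le> ereal I\<close> B by simp
    fix C \<epsilon> \<delta> s :: real
    assume tr: "Re (mat_trace (A * A)) \<le> C * real n" and pos: "\<epsilon> > 0" "\<delta> > 0" "s > 0"
    from hermitian_spectral_decomposition[OF h] obtain d :: "nat \<Rightarrow> real" and u :: "nat \<Rightarrow> nat \<Rightarrow> complex" where
      A: "\<And>i j. i < n \<Longrightarrow> j < n \<Longrightarrow> A $$ (i, j) = (\<Sum>k<n. of_real (d k) * u i k * cnj (u j k))" and
      orth: "\<And>i j. i < n \<Longrightarrow> j < n \<Longrightarrow> (\<Sum>k<n. u i k * cnj (u j k)) = (if i = j then 1 else 0)" and
      roots: "proots (char_poly A) = mset (map (\<lambda>k. complex_of_real (d k)) [0..<n])" and
      trd: "mat_trace (A * A) = of_real (\<Sum>k<n. (d k)\<^sup>2)" by blast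
    define K where "K = {..<n} \<times> (UNIV :: bool set)"
    define v where "v k i = (if snd k then Re (u i (fst k)) else Im (u i (fst k)))" for k :: "nat \<times> bool" and i
    define lam where "lam k = d (fst k)" for k :: "nat \<times> bool"
    have sumK: "(\<Sum>k\<in>K. c (fst k) * (dot n (v k) x)\<^sup>2) =
        (\<Sum>k<n. c k * ((dot n (\<lambda>i. Re (u i k)) x)\<^sup>2 + (dot n (\<lambda>i. Im (u i k)) x)\<^sup>2))" for c x
    proof -
      have "(\<Sum>k\<in>K. c (fst k) * (dot n (v k) x)\<^sup>2) = (\<Sum>k<n. \<Sum>b\<in>UNIV. c k * (dot n (v (k, b)) x)\<^sup>2)"
        unfolding K_def sum.cartesian_product by (simp add: case_prod_beta)
      moreover have "v (k, b) = (if b then (\<lambda>i. Re (u i k)) else (\<lambda>i. Im (u i k)))" for k b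
        by (simp add: v_def fun_eq_iff)
      ultimately show ?thesis by (simp add: UNIV_bool distrib_left add.commute)
    qed
    have card_large: "card {k\<in>K. \<bar>lam k\<bar> > \<epsilon>} = 2 * large_eigenvalues \<epsilon> A"
    proof -
      have "{k\<in>K. \<bar>lam k\<bar> > \<epsilon>} = {k\<in>{..<n}. \<epsilon> < \<bar>d k\<bar>} \<times> UNIV" by (auto simp: K_def lam_def)
      then have "card {k\<in>K. \<bar>lam k\<bar> > \<epsilon>} = 2 * card {k. k < n \<and> \<epsilon> < \<bar>d k\<bar>}" by (simp add: card_cartesian_product)
      moreover have "large_eigenvalues \<epsilon> A = length (filter (\<lambda>k. \<epsilon> < \<bar>d k\<bar>) [0..<n])"
      proof -
        have "large_eigenvalues \<epsilon> A = length (filter (\<lambda>z. \<epsilon> < \<bar>Re z\<bar>) (map (\<lambda>k. complex_of_real (d k)) [0..<n]))"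
          unfolding large_eigenvalues_def roots by (metis mset_filter size_mset)
        then show ?thesis by (simp add: filter_map o_def)
      qed
      moreover have "length (filter (\<lambda>k. \<epsilon> < \<bar>d k\<bar>) [0..<n]) = card {k. k < n \<and> \<epsilon> < \<bar>d k\<bar>}"
        by (simp add: length_filter_conv_card cong: conj_cong)
      ultimately show ?thesis by simp
    qed
    have "I \<le> B + real n * (2 * \<epsilon> + \<delta> * (2 * C + 2) + s * (3 / \<delta> + 2)) +
      real (card {k\<in>K. \<bar>lam k\<bar> > \<epsilon>}) * ln (2 / (1 - exp (- s)))"
      unfolding I
    proof (rule mean_field_upper_bound[where v = v, OF _ _ _ _ _ _ pos])
      show "finite K" "card K \<le> 2 * n" by (auto simp: K_def card_cartesian_product)
      \<comment> \<open>With all coefficients equal to 1 the form is the squared norm by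
        \<open>orth\<close>, so Bessel holds with equality.\<close>
      show "(\<Sum>k\<in>K. (dot n (v k) x)\<^sup>2) \<le> (\<Sum>i<n. (x i)\<^sup>2)" for x
      proof -
        have "complex_of_real (\<Sum>k\<in>K. (dot n (v k) x)\<^sup>2) =
            (\<Sum>i<n. \<Sum>j<n. complex_of_real (x i) * (\<Sum>k<n. u i k * cnj (u j k)) * of_real (x j))"
          using hermitian_quad_form_real_functionals[where n = n and x = x and c = "\<lambda>_. 1" and u = u] sumK[of "\<lambda>_. 1" x] by simp
        also have "\<dots> = (\<Sum>i<n. \<Sum>j<n. complex_of_real (x i) * (if i = j then 1 else 0) * of_real (x j))"
          by (intro sum.cong refl) (simp add: orth)
        also have "\<dots> = of_real (\<Sum>i<n. (x i)\<^sup>2)"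
          by (simp add: power2_eq_square if_distrib[of "\<lambda>z. _ * z"] if_distrib[of "\<lambda>z. z * _"] cong: if_cong)
        finally show ?thesis by (metis of_real_eq_iff order_refl)
      qed
      have "(\<Sum>k\<in>K. (lam k)\<^sup>2) = (\<Sum>k<n. \<Sum>b\<in>(UNIV :: bool set). (d k)\<^sup>2)"
        unfolding K_def sum.cartesian_product by (simp add: lam_def case_prod_beta)
      then show "(\<Sum>k\<in>K. (lam k)\<^sup>2) \<le> 2 * C * real n"
        using tr trd by (simp add: sum_distrib_left[symmetric])
      show "?f x = (\<Sum>k\<in>K. lam k * (dot n (v k) x)\<^sup>2)" for x
      proof -
        have "?f x = Re (\<Sum>i<n. \<Sum>j<n. complex_of_real (x i) * (\<Sum>k<n. of_real (d k) * u i k * cnj (u j k)) * of_real (x j))"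
          unfolding quad_form_def by (intro arg_cong[of _ _ Re] sum.cong refl) (simp add: A)
        then show ?thesis
          unfolding hermitian_quad_form_real_functionals lam_def sumK[of d] by simp
      qed
      show "ereal (?f x) - log_laplace_conj n (uniform_cube n) x \<le> ereal B" if "x \<in> {..<n} \<rightarrow>\<^sub>E {-1..1}" for x
        unfolding B[symmetric] S_def by (rule SUP_upper[OF that])
    qed
    then show "I \<le> B + real n * (2 * \<epsilon> + \<delta> * (2 * C + 2) + s * (3 / \<delta> + 2)) +
        2 * real (large_eigenvalues \<epsilon> A) * ln (2 / (1 - exp (- s)))" unfolding card_large by simp
  qed
qed

section \<open>Counting large eigenvalues\<close>

lemma measure_pmf_of_multiset:
  assumes "M \<noteq> {#}"
  shows "measure (measure_pmf (pmf_of_multiset M)) S = real (size {#x \<in># M. x \<in> S#}) / real (size M)"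
proof -
  have "measure (measure_pmf (pmf_of_multiset M)) S = measure (measure_pmf (pmf_of_multiset M)) (S \<inter> set_mset M)"
    using measure_Int_set_pmf[of "pmf_of_multiset M" S] assms by simp
  also have "\<dots> = (\<Sum>x\<in>S \<inter> set_mset M. real (count M x) / real (size M))"
    using assms by (subst measure_measure_pmf_finite) auto
  also have "\<dots> = real (\<Sum>x\<in>S \<inter> set_mset M. count M x) / real (size M)"
    by (simp add: sum_divide_distrib)
  also have "(\<Sum>x\<in>S \<inter> set_mset M. count M x) = size {#x \<in># M. x \<in> S#}"
    unfolding size_multiset_overloaded_eq by (rule sum.cong) auto
  finally show ?thesis .
qed

lemma cdf_empirical_spectral_measure:
  assumes "A \<in> carrier_mat n n" "n \<ge> 1"
  shows "cdf (empirical_spectral_measure A) y = real (size {#z \<in># proots (char_poly A). Re z \<le> y#}) / real n"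
    and "size (proots (char_poly A)) = n"
proof -
  show sz: "size (proots (char_poly A)) = n"
    using degree_monic_char_poly[OF assms(1)] by (simp add: size_proots_complex)
  then have ne: "proots (char_poly A) \<noteq> {#}" using assms(2) by auto
  have "cdf (empirical_spectral_measure A) y = measure (measure_pmf (pmf_of_multiset (proots (char_poly A)))) (Re -` {..y})"
    unfolding cdf_def empirical_spectral_measure_def by (subst measure_distr) auto
  also have "\<dots> = real (size {#z \<in># proots (char_poly A). Re z \<le> y#}) / real n"
    unfolding measure_pmf_of_multiset[OF ne] sz by simp
  finally show "cdf (empirical_spectral_measure A) y = real (size {#z \<in># proots (char_poly A). Re z \<le> y#}) / real n" .
qed

text \<open>Both \<epsilon> and -\<epsilon> are continuity points of the distribution function of
  the Dirac mass at 0, and 1 - F(\<epsilon>) + F(-\<epsilon>) dominates the proportion of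
  eigenvalues larger than \<epsilon> in modulus.\<close>

lemma large_eigenvalues_negligible:
  assumes car: "\<And>n. n \<ge> 1 \<Longrightarrow> A n \<in> carrier_mat n n"
    and w: "weak_conv_m (\<lambda>n. empirical_spectral_measure (A n)) (return borel 0)"
    and \<epsilon>: "\<epsilon> > 0"
  shows "(\<lambda>n. real (large_eigenvalues \<epsilon> (A n)) / real n) \<longlonglongrightarrow> 0"
proof -
  let ?F = "\<lambda>n. cdf (empirical_spectral_measure (A n))"
  have cdf0: "cdf (return borel 0) y = (if 0 \<le> y then 1 else 0)" for y :: real
    by (simp add: cdf_def measure_return)
  have lim: "(\<lambda>n. ?F n y) \<longlonglongrightarrow> (if 0 \<le> y then 1 else 0)" if "y \<noteq> 0" for y
  proof -
    have "isCont (cdf (return borel 0)) y"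
    proof (cases "y > 0")
      case True
      have "\<forall>\<^sub>F x in nhds y. cdf (return borel 0) x = (1 :: real)"
        by (intro eventually_mono[OF eventually_nhds_in_open[of "{0<..}" y]]) (use True in \<open>auto simp: cdf0\<close>)
      then show ?thesis by (subst isCont_cong[where g = "\<lambda>_. 1"]) auto
    next
      case False
      have "\<forall>\<^sub>F x in nhds y. cdf (return borel 0) x = (0 :: real)"
        by (intro eventually_mono[OF eventually_nhds_in_open[of "{..<0}" y]]) (use False that in \<open>auto simp: cdf0\<close>)
      then show ?thesis by (subst isCont_cong[where g = "\<lambda>_. 0"]) auto
    qed
    then show ?thesis using w unfolding weak_conv_m_def weak_conv_def by (simp add: cdf0)
  qed
  have "(\<lambda>n. 1 - ?F n \<epsilon> + ?F n (- \<epsilon>)) \<longlonglongrightarrow> 1 - (if 0 \<le> \<epsilon> then 1 else 0) + (if 0 \<le> - \<epsilon> then 1 else 0)"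
    using \<epsilon> by (intro tendsto_intros lim) auto
  then have "(\<lambda>n. 1 - ?F n \<epsilon> + ?F n (- \<epsilon>)) \<longlonglongrightarrow> 0" using \<epsilon> by simp
  then show ?thesis
  proof (rule Lim_null_comparison[rotated])
    show "\<forall>\<^sub>F n in sequentially. norm (real (large_eigenvalues \<epsilon> (A n)) / real n) \<le> 1 - ?F n \<epsilon> + ?F n (- \<epsilon>)"
      using eventually_ge_at_top[of 1]
    proof eventually_elim
      case (elim n)
      let ?P = "proots (char_poly (A n))"
      \<comment> \<open>Only an inequality: an eigenvalue equal to -\<epsilon> is counted by
        F(-\<epsilon>) although its modulus does not exceed \<epsilon>.\<close>
      have "size {#z \<in># M. \<epsilon> < \<bar>Re z\<bar>#} + size {#z \<in># M. Re z \<le> \<epsilon>#} \<le> size M + size {#z \<in># M. Re z \<le> - \<epsilon>#}" for M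
        by (induction M) (auto simp: abs_if)
      from this[of ?P] have "large_eigenvalues \<epsilon> (A n) + size {#z \<in># ?P. Re z \<le> \<epsilon>#} \<le> n + size {#z \<in># ?P. Re z \<le> - \<epsilon>#}"
        by (simp only: large_eigenvalues_def cdf_empirical_spectral_measure(2)[OF car[OF elim] elim])
      then have "real (large_eigenvalues \<epsilon> (A n)) + real (size {#z \<in># ?P. Re z \<le> \<epsilon>#}) \<le> real n + real (size {#z \<in># ?P. Re z \<le> - \<epsilon>#})"
        by linarith
      then show ?case
        using elim unfolding cdf_empirical_spectral_measure(1)[OF car[OF elim] elim] by (simp add: field_simps)
    qed
  qed
qed

section \<open>Choice of the constants and passage to the limit\<close>

theorem proposition1p10:
  fixes A :: "nat \<Rightarrow> complex mat"
  assumes "\<And>n. n \<ge> 1 \<Longrightarrow> hermitian_mat n (A n)"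
    and "\<And>n i. n \<ge> 1 \<Longrightarrow> i < n \<Longrightarrow> A n $$ (i, i) = 0"
    and "weak_conv_m (\<lambda>n. empirical_spectral_measure (A n)) (return borel 0)"
    and "limsup (\<lambda>n. ereal (Re (mat_trace (A n * A n)) / real n)) < \<infinity>"
  shows "\<exists>e :: nat \<Rightarrow> real. e \<in> o(\<lambda>n. real n) \<and>
    (\<forall>n\<ge>1. ereal (ln (\<integral>\<sigma>. exp (quad_form n (A n) \<sigma>) \<partial>uniform_cube n)) =
       (SUP x\<in>{..<n} \<rightarrow>\<^sub>E {-1..1}.
          ereal (quad_form n (A n) x) - log_laplace_conj n (uniform_cube n) x) + ereal (e n))"
proof -
  let ?I = "\<lambda>n. ln (\<integral>\<sigma>. exp (quad_form n (A n) \<sigma>) \<partial>uniform_cube n)"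
  let ?S = "\<lambda>n. SUP x\<in>{..<n} \<rightarrow>\<^sub>E {-1..1}. ereal (quad_form n (A n) x) - log_laplace_conj n (uniform_cube n) x"
  \<comment> \<open>Bundling the facts into one predicate yields a single \<open>B n\<close> for
    each \<open>n\<close>, independent of the constants fixed later for each
    \<open>\<eta>\<close>.\<close>
  define P where "P n B \<longleftrightarrow> ?S n = ereal B \<and> B \<le> ?I n \<and>
      (\<forall>C \<epsilon> \<delta> s. Re (mat_trace (A n * A n)) \<le> C * real n \<longrightarrow> \<epsilon> > 0 \<longrightarrow> \<delta> > 0 \<longrightarrow> s > 0 \<longrightarrow>
        ?I n \<le> B + real n * (2 * \<epsilon> + \<delta> * (2 * C + 2) + s * (3 / \<delta> + 2)) +
        2 * real (large_eigenvalues \<epsilon> (A n)) * ln (2 / (1 - exp (- s))))" for n B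
  have "\<exists>B. P n B" if n: "n \<ge> 1" for n
  proof (rule mean_field_approximation[OF assms(1)[OF n] assms(2)[OF n]])
    fix B
    assume "?S n = ereal B" "B \<le> ?I n"
      "\<And>C \<epsilon> \<delta> s. Re (mat_trace (A n * A n)) \<le> C * real n \<Longrightarrow> \<epsilon> > 0 \<Longrightarrow> \<delta> > 0 \<Longrightarrow> s > 0 \<Longrightarrow>
        ?I n \<le> B + real n * (2 * \<epsilon> + \<delta> * (2 * C + 2) + s * (3 / \<delta> + 2)) +
        2 * real (large_eigenvalues \<epsilon> (A n)) * ln (2 / (1 - exp (- s)))"
    then show ?thesis unfolding P_def by (intro exI[of _ B] conjI allI impI)
  qed
  then obtain B where B: "P n (B n)" if "n \<ge> 1" for n by metis
  note B = B[unfolded P_def, THEN conjunct1] B[unfolded P_def, THEN conjunct2, THEN conjunct1]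
    B[unfolded P_def, THEN conjunct2, THEN conjunct2, rule_format]
  have "limsup (\<lambda>n. ereal (Re (mat_trace (A n * A n)) / real n)) \<noteq> \<infinity>"
    using assms(4) by (simp only: less_top[symmetric] top_ereal_def)
  then obtain m :: nat where "limsup (\<lambda>n. ereal (Re (mat_trace (A n * A n)) / real n)) < ereal (real m)"
    unfolding less_PInf_Ex_of_nat by blast
  then have trace: "\<forall>\<^sub>F n in sequentially. ereal (Re (mat_trace (A n * A n)) / real n) < ereal (real m)"
    by (rule Limsup_lessD)
  define C where "C = real m"
  have "(\<lambda>n. ?I n - B n) \<in> o(\<lambda>n. real n)"
  proof (rule landau_o.smallI)
    fix \<eta> :: real assume \<eta>: "\<eta> > 0"
    have C: "C \<ge> 0" by (simp add: C_def)
    \<comment> \<open>The budget \<eta> is split into quarters: the terms in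
      \<open>\<epsilon>\<close>, \<open>\<delta>\<close> and \<open>s\<close> take one each, the
      large eigenvalues the last once \<open>n\<close> is large. \<open>s\<close> comes after
      \<open>\<delta>\<close> because its coefficient contains 1/\<delta>.\<close>
    define \<epsilon> where "\<epsilon> = \<eta> / 8"
    define \<delta> where "\<delta> = \<eta> / (4 * (2 * C + 2))"
    define s where "s = \<eta> / (4 * (3 / \<delta> + 2))"
    define H where "H = ln (2 / (1 - exp (- s)))"
    have pos: "\<epsilon> > 0" "\<delta> > 0" using \<eta> C by (auto simp: \<epsilon>_def \<delta>_def)
    then have "3 / \<delta> + 2 > 0" by (simp add: add_pos_pos)
    then have spos: "s > 0" using \<eta> by (simp add: s_def)
    have quarter: "\<eta> / (4 * D) * D = \<eta> / 4" if "D > 0" for D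
      using that by simp
    have d: "\<delta> * (2 * C + 2) = \<eta> / 4" unfolding \<delta>_def by (rule quarter) (use C in simp)
    have s: "s * (3 / \<delta> + 2) = \<eta> / 4" unfolding s_def by (rule quarter) fact
    have "(\<lambda>n. 2 * H * (real (large_eigenvalues \<epsilon> (A n)) / real n)) \<longlonglongrightarrow> 2 * H * 0"
      using assms(1,3) pos by (intro tendsto_intros large_eigenvalues_negligible) (auto simp: hermitian_mat_def)
    then have "\<forall>\<^sub>F n in sequentially. 2 * H * (real (large_eigenvalues \<epsilon> (A n)) / real n) < \<eta> / 4"
      using \<eta> by (intro order_tendstoD) auto
    with trace show "\<forall>\<^sub>F n in sequentially. norm (?I n - B n) \<le> \<eta> * norm (real n)"
      using eventually_ge_at_top[of 1]
    proof eventually_elim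
      case (elim n)
      have tr: "Re (mat_trace (A n * A n)) \<le> C * real n"
        using elim by (simp add: C_def field_simps)
      have "2 * real (large_eigenvalues \<epsilon> (A n)) * H \<le> real n * (\<eta> / 4)"
        using elim by (simp add: field_simps)
      moreover have e: "2 * \<epsilon> = \<eta> / 4" by (simp add: \<epsilon>_def)
      have "?I n \<le> B n + real n * (\<eta> / 4 + \<eta> / 4 + \<eta> / 4) + 2 * real (large_eigenvalues \<epsilon> (A n)) * H"
        using B(3)[OF elim(3) tr pos spos] by (simp only: d s e H_def)
      ultimately have "?I n \<le> B n + real n * (\<eta> / 4 + \<eta> / 4 + \<eta> / 4) + real n * (\<eta> / 4)"
        by linarith
      \<comment> \<open>The exact lower bound \<open>B n \<le> ?I n\<close> removes the absolute
        value, so the upper estimate suffices.\<close>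
      then show ?case using B(2)[OF elim(3)] by (simp add: algebra_simps)
    qed
  qed
  moreover have "ereal (?I n) = ?S n + ereal (?I n - B n)" if "n \<ge> 1" for n
    using B(1)[OF that] by simp
  ultimately show ?thesis by (intro exI[of _ "\<lambda>n. ?I n - B n"]) blast
qed

end
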